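(* (i) Let $I$ be an interval and let $\Gamma=\mathrm{Aut}(I)$ be the group of order automorphisms of $I$. Then $\Gamma$ acts on the set of cyclic structures on the associated point $p_I$ of the topos $\hat\Delta$ of simplicial sets. (ii) Let $I=[0,1]\subset\mathbb R$. Then the associated point $p_{[0,1]}$ of $\hat\Delta$ admits a continuum of cyclic structures.
   Context: An interval is a totally ordered set $I$ with a smallest element $b$ and a largest element $t$, $b<t$. $\Delta$ is the simplicial category: objects $[n]=\{0,\dots,n\}$, $n\ge0$, morphisms the non-decreasing maps. The cyclic category $\Lambda$ has one object $[n]$ for each $n\ge 0$, and $\mathrm{Hom}_\Lambda([n],[m])$ is the set of non-decreasing maps $f:\mathbb Z\to\mathbb Z$ with $f(x+n+1)=f(x)+m+1$ for all $x$, modulo $f\sim f+k(m+1)$, $k\in\mathbb Z$; composition is composition of maps. The inclusion $j:\Delta\hookrightarrow\Lambda$ is the identity on objects and $j(f)(x+k(n+1))=f(x)+k(m+1)$ for $f\in\mathrm{Hom}_\Delta([n],[m])$, $x\in[n]$, $k\in\mathbb Z$. The point $p_I$ of $\hat\Delta=\mathrm{Sets}^{\Delta^{\rm op}}$ is given by the flat covariant functor $\mathcal F_I:\Delta\to\mathrm{Sets}$, where $\mathcal F_I([n])$ is the set of non-decreasing sequences $\beta=(\beta_j)_{0\le j\le n+1}$ in $I$ with $\beta_0=b$, $\beta_{n+1}=t$, and for $f\in\mathrm{Hom}_\Delta([n],[m])$, $(f_*\beta)_j=\beta_{f^*(j)}$ with $f^*(j)=\min\{i\in[n]: f(i)\ge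 j\}$ (and $f^*(j)=n+1$ if there is no such $i$), $0\le j\le m+1$. A cyclic structure on $p_I$ is an extension of $\mathcal F_I$ to a functor $\tilde{\mathcal F}:\Lambda\to\mathrm{Sets}$, i.e. a functor with $\tilde{\mathcal F}\circ j=\mathcal F_I$. *)

theory Defs
  imports Complex_Main "HOL-Algebra.Group_Action" "HOL-Library.Equipollence"
begin

text \<open>
  The object \<open>[n]\<close> of both the simplicial and the cyclic category is represented by the natural
  number \<open>n\<close>, the set \<open>[n]\<close> by \<open>{..n}\<close>. Functions between sets are extensional, so that equality of
  maps and of functors is equality in HOL.
\<close>

definition order_interval :: "'a::linorder set \<Rightarrow> 'a \<Rightarrow> 'a \<Rightarrow> bool" where
  "order_interval I b t \<longleftrightarrow> b \<in> I \<and> t \<in> I \<and> b < t \<and> (\<forall>x\<in>I. b \<le> x \<and> x \<le> t)"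


subsection \<open>The simplicial and the cyclic category\<close>

definition delta_hom :: "nat \<Rightarrow> nat \<Rightarrow> (nat \<Rightarrow> nat) set" where
  "delta_hom n m = {f \<in> {..n} \<rightarrow>\<^sub>E {..m}. mono_on {..n} f}"

definition lambda_map :: "nat \<Rightarrow> nat \<Rightarrow> (int \<Rightarrow> int) set" where
  "lambda_map n m = {f. mono f \<and> (\<forall>x. f (x + int n + 1) = f x + int m + 1)}"

definition lambda_rel :: "nat \<Rightarrow> nat \<Rightarrow> ((int \<Rightarrow> int) \<times> (int \<Rightarrow> int)) set" where
  "lambda_rel n m = {(f, g). f \<in> lambda_map n m \<and> g \<in> lambda_map n m \<and>
                             (\<exists>k. \<forall>x. g x = f x + k * (int m + 1))}"

definition lambda_class :: "nat \<Rightarrow> nat \<Rightarrow> (int \<Rightarrow> int) \<Rightarrow> (int \<Rightarrow> int) set" where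
  "lambda_class n m f = lambda_rel n m `` {f}"

definition lambda_hom :: "nat \<Rightarrow> nat \<Rightarrow> (int \<Rightarrow> int) set set" where
  "lambda_hom n m = lambda_map n m // lambda_rel n m"

definition lambda_id :: "nat \<Rightarrow> (int \<Rightarrow> int) set" where
  "lambda_id n = lambda_class n n id"

text \<open>
  The elementwise composite of two classes is again a full class, namely that of the composite of
  any representatives; see \<open>lambda_comp_class\<close> below.
\<close>

definition lambda_comp :: "(int \<Rightarrow> int) set \<Rightarrow> (int \<Rightarrow> int) set \<Rightarrow> (int \<Rightarrow> int) set" where
  "lambda_comp G F = {g \<circ> f | g f. g \<in> G \<and> f \<in> F}"

text \<open>
  Every integer is uniquely \<open>x + k(n+1)\<close> with \<open>x \<in> [n]\<close>; the two parts are its remainder and its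
  quotient modulo \<open>n+1\<close>.
\<close>

definition delta_to_lambda :: "nat \<Rightarrow> nat \<Rightarrow> (nat \<Rightarrow> nat) \<Rightarrow> (int \<Rightarrow> int) set" where
  "delta_to_lambda n m f =
     lambda_class n m
       (\<lambda>y. int (f (nat (y mod (int n + 1)))) + (y div (int n + 1)) * (int m + 1))"


subsection \<open>The flat functor of an interval\<close>

definition interval_obj :: "'a::linorder set \<Rightarrow> 'a \<Rightarrow> 'a \<Rightarrow> nat \<Rightarrow> (nat \<Rightarrow> 'a) set" where
  "interval_obj I b t n =
     {\<beta> \<in> {..n+1} \<rightarrow>\<^sub>E I. mono_on {..n+1} \<beta> \<and> \<beta> 0 = b \<and> \<beta> (n+1) = t}"

definition dual_map :: "nat \<Rightarrow> (nat \<Rightarrow> nat) \<Rightarrow> nat \<Rightarrow> nat" where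
  "dual_map n f j =
     (if \<exists>i\<le>n. j \<le> f i then LEAST i. i \<le> n \<and> j \<le> f i else n + 1)"

definition interval_mor ::
  "'a::linorder set \<Rightarrow> 'a \<Rightarrow> 'a \<Rightarrow> nat \<Rightarrow> nat \<Rightarrow> (nat \<Rightarrow> nat) \<Rightarrow> (nat \<Rightarrow> 'a) \<Rightarrow> (nat \<Rightarrow> 'a)" where
  "interval_mor I b t n m f =
     (\<lambda>\<beta>\<in>interval_obj I b t n. \<lambda>j\<in>{..m+1}. \<beta> (dual_map n f j))"


subsection \<open>Cyclic structures\<close>

text \<open>A functor from the cyclic category to sets is a pair (object part, morphism part).\<close>

type_synonym 'x lambda_set =
  "(nat \<Rightarrow> 'x set) \<times> (nat \<Rightarrow> nat \<Rightarrow> (int \<Rightarrow> int) set \<Rightarrow> 'x \<Rightarrow> 'x)"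

definition lambda_functor :: "'x lambda_set \<Rightarrow> bool" where
  "lambda_functor = (\<lambda>(Fo, Fm).
     (\<forall>n m. Fm n m \<in> lambda_hom n m \<rightarrow>\<^sub>E (Fo n \<rightarrow>\<^sub>E Fo m)) \<and>
     (\<forall>n. Fm n n (lambda_id n) = (\<lambda>x\<in>Fo n. x)) \<and>
     (\<forall>n m p. \<forall>f\<in>lambda_hom n m. \<forall>g\<in>lambda_hom m p.
        Fm n p (lambda_comp g f) = compose (Fo n) (Fm m p g) (Fm n m f)))"

definition cyclic_structures ::
  "'a::linorder set \<Rightarrow> 'a \<Rightarrow> 'a \<Rightarrow> (nat \<Rightarrow> 'a) lambda_set set" where
  "cyclic_structures I b t =
     {(Fo, Fm). lambda_functor (Fo, Fm) \<and>
        (\<forall>n. Fo n = interval_obj I b t n) \<and>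
        (\<forall>n m. \<forall>f\<in>delta_hom n m. Fm n m (delta_to_lambda n m f) = interval_mor I b t n m f)}"


subsection \<open>The action of the order automorphisms\<close>

definition order_aut :: "'a::linorder set \<Rightarrow> ('a \<Rightarrow> 'a) monoid" where
  "order_aut I = (BijGroup I)
     \<lparr>carrier := {\<gamma> \<in> Bij I. \<forall>x\<in>I. \<forall>y\<in>I. \<gamma> x \<le> \<gamma> y \<longleftrightarrow> x \<le> y}\<rparr>"

definition aut_on_obj ::
  "'a::linorder set \<Rightarrow> 'a \<Rightarrow> 'a \<Rightarrow> ('a \<Rightarrow> 'a) \<Rightarrow> nat \<Rightarrow> (nat \<Rightarrow> 'a) \<Rightarrow> (nat \<Rightarrow> 'a)" where
  "aut_on_obj I b t \<gamma> n = (\<lambda>\<beta>\<in>interval_obj I b t n. \<lambda>j\<in>{..n+1}. \<gamma> (\<beta> j))"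

text \<open>
  An order automorphism \<open>\<gamma>\<close> fixes both endpoints, so applying it termwise to sequences is a natural
  automorphism of the functor of the interval. It acts on cyclic structures by transport of
  structure: the map of \<open>f : [n] \<rightarrow> [m]\<close> becomes its conjugate by this natural automorphism.
\<close>

definition aut_action ::
  "'a::linorder set \<Rightarrow> 'a \<Rightarrow> 'a \<Rightarrow> ('a \<Rightarrow> 'a) \<Rightarrow>
     (nat \<Rightarrow> 'a) lambda_set \<Rightarrow> (nat \<Rightarrow> 'a) lambda_set" where
  "aut_action I b t \<gamma> =
     (\<lambda>(Fo, Fm)\<in>cyclic_structures I b t.
        (Fo, \<lambda>n m. \<lambda>f\<in>lambda_hom n m.
           compose (Fo n) (aut_on_obj I b t \<gamma> m)
             (compose (Fo n) (Fm n m f) (aut_on_obj I b t (inv\<^bsub>order_aut I\<^esub> \<gamma>) n))))"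


subsection \<open>Well-definedness of composition\<close>

lemma lambda_class_eq:
  assumes "f \<in> lambda_map n m"
  shows "lambda_class n m f = {\<lambda>x. f x + k * (int m + 1) | k. True}"
proof -
  have "(\<lambda>x. f x + k * (int m + 1)) \<in> lambda_map n m" for k
    using assms by (auto simp: lambda_map_def mono_def)
  then show ?thesis
    using assms unfolding lambda_class_def lambda_rel_def fun_eq_iff[symmetric] by blast
qed

lemma lambda_map_shift:
  assumes "f \<in> lambda_map n m"
  shows "f (x + k * (int n + 1)) = f x + k * (int m + 1)"
proof (induction k rule: int_induct[where k = 0])
  case (step1 i)
  have "f ((x + i * (int n + 1)) + int n + 1) = f (x + i * (int n + 1)) + int m + 1"
    using assms unfolding lambda_map_def by blast
  with step1 show ?case by (simp add: algebra_simps)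
next
  case (step2 i)
  have "f ((x + (i - 1) * (int n + 1)) + int n + 1) = f (x + (i - 1) * (int n + 1)) + int m + 1"
    using assms unfolding lambda_map_def by blast
  with step2 show ?case by (simp add: algebra_simps)
qed simp

lemma lambda_map_comp:
  assumes "f \<in> lambda_map n m" "g \<in> lambda_map m p"
  shows "g \<circ> f \<in> lambda_map n p"
proof -
  have "g (f (x + int n + 1)) = g (f x) + int p + 1" for x
    using assms unfolding lambda_map_def by (metis (mono_tags, lifting) mem_Collect_eq)
  then show ?thesis
    using assms by (auto simp: lambda_map_def mono_def)
qed

lemma lambda_comp_class:
  assumes f: "f \<in> lambda_map n m" and g: "g \<in> lambda_map m p"
  shows "lambda_comp (lambda_class m p g) (lambda_class n m f) = lambda_class n p (g \<circ> f)"
proof -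
  have "(\<lambda>x. g x + l * (int p + 1)) \<circ> (\<lambda>x. f x + k * (int m + 1))
        = (\<lambda>x. (g \<circ> f) x + (k + l) * (int p + 1))" for k l
    unfolding comp_def lambda_map_shift[OF g] by (simp add: algebra_simps)
  note comp_shift = this
  show ?thesis
    unfolding lambda_class_eq[OF f] lambda_class_eq[OF g]
      lambda_class_eq[OF lambda_map_comp[OF f g]] lambda_comp_def
  proof (intro Set.set_eqI iffI)
    fix h
    assume "h \<in> {\<lambda>x. (g \<circ> f) x + k * (int p + 1) | k. True}"
    then obtain k where "h = (\<lambda>x. (g \<circ> f) x + (k + 0) * (int p + 1))" by auto
    then have "h = (\<lambda>x. g x + 0 * (int p + 1)) \<circ> (\<lambda>x. f x + k * (int m + 1))"
      by (simp only: comp_shift)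
    then show "h \<in> {g' \<circ> f' | g' f'. g' \<in> {\<lambda>x. g x + k * (int p + 1) | k. True} \<and>
                                     f' \<in> {\<lambda>x. f x + k * (int m + 1) | k. True}}"
      by blast
  qed (use comp_shift in blast)
qed

end

theory Submission
  imports Defs "HOL-Analysis.Abstract_Topology_2"
begin

text \<open>
  An automorphism of the interval acts termwise on its flat functor, so conjugation by it permutes the
  extensions of that functor to the cyclic category.

  A morphism \<open>f\<close> of the cyclic category is determined by its lower adjoint, the non-decreasing map
  that lists the positions where \<open>f\<close> jumps. Composing with the maps \<open>[m] \<rightarrow> [1]\<close>, one finds that a
  cyclic structure is determined by one function \<open>\<rho>(u, v)\<close> on pairs \<open>u \<le> v\<close> in \<open>I\<close>, which behaves like
  \<open>u\<inverse>v\<close> in a left-ordered group: it is monotone in \<open>v\<close>, injective in \<open>u\<close>, surjective in both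
  arguments, and satisfies \<open>\<rho>(\<rho>(u, v), \<rho>(u, w)) = \<rho>(v, w)\<close>. For \<open>I = [0,1]\<close> completeness makes \<open>\<rho>\<close>
  antitone in \<open>u\<close>; monotone surjections are determined by rational data, so there are at most
  continuum many structures. Conversely \<open>\<rho>(u, v) = v - u\<close> comes from a cyclic structure, and its
  conjugates by the automorphisms \<open>x \<mapsto> x powr exp a\<close> are pairwise distinct.
\<close>

subsection \<open>Lower adjoints of cyclic maps\<close>

definition lower_adj :: "(int \<Rightarrow> int) \<Rightarrow> int \<Rightarrow> int" where
  "lower_adj f j = (THE a. \<forall>y. a \<le> y \<longleftrightarrow> j \<le> f y)"

lemma lower_adj_iff:
  assumes f: "f \<in> lambda_map n m"
  shows "lower_adj f j \<le> y \<longleftrightarrow> j \<le> f y"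
proof -
  \<comment> \<open>Over a period \<open>f\<close> rises by \<open>m+1 >= 1\<close>, so
    \<open>K\<close> periods above 0 it has reached \<open>j\<close> and \<open>K\<close> periods
    below it is still under \<open>j\<close>. A least argument exists, and it can be sought as a
    natural offset from \<open>z\<close>.\<close>
  define K where "K = \<bar>j\<bar> + \<bar>f 0\<bar> + 1"
  have mono: "f x \<le> f y" if "x \<le> y" for x y
    using f that by (auto simp: lambda_map_def mono_def)
  have K: "K \<ge> 1" by (simp add: K_def)
  then have big: "K \<le> K * (int m + 1)" by simp
  define z where "z = - K * (int n + 1)"
  have K_bounds: "j \<le> f 0 + K" "f 0 - K < j" by (simp_all add: K_def)
  define M where "M = K * (int m + 1)"
  have "f (K * (int n + 1)) = f 0 + M" "f z = f 0 - M"
    using lambda_map_shift[OF f, of 0 K] lambda_map_shift[OF f, of 0 "- K"]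
    by (simp_all only: M_def z_def add_0 mult_minus_left diff_conv_add_uminus)
  moreover have "K \<le> M"
    using big by (simp only: M_def)
  ultimately have up: "j \<le> f (K * (int n + 1))" and lo: "f z < j"
    using K_bounds by simp_all
  define k where "k = (LEAST k::nat. j \<le> f (z + int k))"
  have "z \<le> K * (int n + 1)"
    using K by (simp add: z_def)
  then have ex: "j \<le> f (z + int (nat (K * (int n + 1) - z)))"
    using up by simp
  have k: "j \<le> f (z + int k)"
    unfolding k_def by (rule LeastI[of "\<lambda>k. j \<le> f (z + int k)", OF ex])
  have iff: "z + int k \<le> y \<longleftrightarrow> j \<le> f y" for y
  proof
    assume "z + int k \<le> y"
    from k mono[OF this] show "j \<le> f y" by (rule order.trans)
  next
    assume "j \<le> f y"
    with lo mono[of y z] have "z < y" by force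
    then have "y = z + int (nat (y - z))" by simp
    with \<open>j \<le> f y\<close> have "k \<le> nat (y - z)"
      unfolding k_def by (intro Least_le) (simp only:)
    with \<open>z < y\<close> show "z + int k \<le> y" by simp
  qed
  have "lower_adj f j = z + int k"
    unfolding lower_adj_def
  proof (rule the_equality)
    fix a assume "\<forall>y. a \<le> y \<longleftrightarrow> j \<le> f y"
    then show "a = z + int k"
      using iff[of a] iff[of "z + int k"] by (metis order.antisym order.refl)
  qed (simp add: iff)
  then show ?thesis by (simp add: iff)
qed

lemma lower_adj_eqI:
  assumes "f \<in> lambda_map n m" "j \<le> f a" "f (a - 1) < j"
  shows "lower_adj f j = a"
  using lower_adj_iff[OF assms(1), of j a] lower_adj_iff[OF assms(1), of j "a - 1"] assms by linarith

lemma lower_adj_mono: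
  assumes "f \<in> lambda_map n m" "i \<le> j"
  shows "lower_adj f i \<le> lower_adj f j"
  using lower_adj_iff[OF assms(1), of i "lower_adj f j"] lower_adj_iff[OF assms(1), of j "lower_adj f j"]
    assms(2) by simp

lemma lower_adj_shift:
  assumes f: "f \<in> lambda_map n m"
  shows "lower_adj f (j + k * (int m + 1)) = lower_adj f j + k * (int n + 1)"
proof (rule lower_adj_eqI[OF f])
  show "j + k * (int m + 1) \<le> f (lower_adj f j + k * (int n + 1))"
    using lower_adj_iff[OF f, of j "lower_adj f j"] by (simp add: lambda_map_shift[OF f])
  have "f (lower_adj f j - 1) < j"
    using lower_adj_iff[OF f, of j "lower_adj f j - 1"] by simp
  then show "f (lower_adj f j + k * (int n + 1) - 1) < j + k * (int m + 1)"
    using lambda_map_shift[OF f, of "lower_adj f j - 1" k] by (simp add: algebra_simps)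
qed

lemma lower_adj_comp:
  assumes f: "f \<in> lambda_map n m" and g: "g \<in> lambda_map m p"
  shows "lower_adj (g \<circ> f) j = lower_adj f (lower_adj g j)"
proof -
  have "lower_adj (g \<circ> f) j \<le> y \<longleftrightarrow> lower_adj f (lower_adj g j) \<le> y" for y
    by (simp add: lower_adj_iff[OF lambda_map_comp[OF f g]] lower_adj_iff[OF f] lower_adj_iff[OF g])
  from this[of "lower_adj (g \<circ> f) j"] this[of "lower_adj f (lower_adj g j)"]
  show ?thesis by simp
qed

text \<open>By the adjunction, \<open>lower_adj\<close> decides every comparison
  \<open>j <= f y\<close> and hence determines \<open>f\<close>; periodicity reduces the check to
  one period.\<close>

lemma lambda_map_eqI:
  assumes f: "f \<in> lambda_map n m" and g: "g \<in> lambda_map n m"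
    and eq: "\<And>j. 0 \<le> j \<Longrightarrow> j \<le> int m \<Longrightarrow> lower_adj f j = lower_adj g j"
  shows "f = g"
proof
  fix y
  have "lower_adj f j = lower_adj g j" for j
  proof -
    have "0 \<le> j mod (int m + 1)" "j mod (int m + 1) \<le> int m"
      using pos_mod_sign[of "int m + 1" j] pos_mod_bound[of "int m + 1" j] by auto
    from eq[OF this] show ?thesis
      using lower_adj_shift[OF f, of "j mod (int m + 1)" "j div (int m + 1)"]
        lower_adj_shift[OF g, of "j mod (int m + 1)" "j div (int m + 1)"]
      unfolding mod_div_mult_eq by simp
  qed
  then have "j \<le> f y \<longleftrightarrow> j \<le> g y" for j
    using lower_adj_iff[OF f] lower_adj_iff[OF g] by metis
  from this[of "f y"] this[of "g y"] show "f y = g y" by simp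
qed

lemma lower_adj_id: "lower_adj id j = j"
  by (rule lower_adj_eqI[of _ 0 0]) (auto simp: lambda_map_def mono_def)

section \<open>Cyclic maps to [1] and [2] with prescribed jumps\<close>

lemma div_shift1: "(x + int n + 1) div (int n + 1) = x div (int n + 1) + 1"
  using div_add_self2[of "int n + 1" x] by (simp add: add.assoc)

lemma div_unit:
  assumes "k * (int n + 1) \<le> x" "x < (k + 1) * (int n + 1)"
  shows "x div (int n + 1) = k"
  using int_div_pos_eq[of x "int n + 1" k "x - k * (int n + 1)"] assms by (simp add: algebra_simps)

text \<open>
  The map to \<open>[1]\<close> whose value jumps to an even integer at \<open>c\<close> and to an odd one at \<open>d\<close>, modulo \<open>n+1\<close>;
  \<open>arc3\<close> below is the analogue with three jumps and values in \<open>[2]\<close>.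
\<close>

definition arc :: "nat \<Rightarrow> int \<Rightarrow> int \<Rightarrow> int \<Rightarrow> int" where
  "arc n c d y = (y - c) div (int n + 1) + (y - d) div (int n + 1) + 1"

lemma arc_lambda_map: "arc n c d \<in> lambda_map n 1"
proof -
  have "arc n c d (x + int n + 1) = arc n c d x + int 1 + 1" for x
    using div_shift1[of "x - c" n] div_shift1[of "x - d" n]
    by (simp add: arc_def algebra_simps)
  moreover have "mono (arc n c d)"
    by (auto simp: mono_def arc_def intro!: add_mono zdiv_mono1)
  ultimately show ?thesis by (simp add: lambda_map_def)
qed

text \<open>Each quotient in \<open>arc\<close> rises by one at its own cut modulo
  \<open>n+1\<close>. The hypotheses make the two families of cuts alternate, coincidences allowed,
  and the summand 1 normalises the value 0 to be reached at \<open>c\<close>.\<close>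

lemma lower_adj_arc:
  assumes "c \<le> d" "d \<le> c + int n + 1"
  shows "lower_adj (arc n c d) 0 = c" "lower_adj (arc n c d) 1 = d"
proof -
  have 1: "(c - d) div (int n + 1) = 0 \<or> (c - d) div (int n + 1) = -1"
    using div_unit[of 0 n "c - d"] div_unit[of "-1" n "c - d"] assms by force
  have 2: "(c - 1 - d) div (int n + 1) \<le> -1"
    using assms zdiv_mono1[of "c - 1 - d" "-1" "int n + 1"] div_unit[of "-1" n "-1"] by simp
  have 3: "(d - c) div (int n + 1) \<ge> 0"
    using assms by (simp add: pos_imp_zdiv_nonneg_iff)
  have 4: "(d - 1 - c) div (int n + 1) \<le> 0"
    using assms zdiv_mono1[of "d - 1 - c" "int n" "int n + 1"] by simp
  have 5: "(-1) div (int n + 1) = -1" using div_unit[of "-1" n "-1"] by simp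
  show "lower_adj (arc n c d) 0 = c"
    by (rule lower_adj_eqI[OF arc_lambda_map]) (use 1 2 5 in \<open>auto simp: arc_def\<close>)
  show "lower_adj (arc n c d) 1 = d"
    by (rule lower_adj_eqI[OF arc_lambda_map]) (use 3 4 5 in \<open>auto simp: arc_def\<close>)
qed

lemma lower_adj_le:
  assumes f: "f \<in> lambda_map n m" and "i \<le> j" "j \<le> i + int m + 1"
  shows "lower_adj f i \<le> lower_adj f j" "lower_adj f j \<le> lower_adj f i + int n + 1"
  using lower_adj_mono[OF f, of i j] lower_adj_mono[OF f, of j "i + int m + 1"]
    lower_adj_shift[OF f, of i 1] assms by (simp_all add: add.assoc)

text \<open>Adjoints reverse composition, so precomposing with \<open>f\<close> only moves the two
  jumps, and a cyclic map to [1] is determined by where it jumps to 0 and to 1.\<close>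

lemma arc_comp:
  assumes f: "f \<in> lambda_map n m" and ij: "i \<le> j" "j \<le> i + int m + 1"
  shows "arc m i j \<circ> f = arc n (lower_adj f i) (lower_adj f j)"
proof (rule lambda_map_eqI)
  show "arc m i j \<circ> f \<in> lambda_map n 1"
    by (rule lambda_map_comp[OF f arc_lambda_map])
  fix k :: int assume "0 \<le> k" "k \<le> int 1"
  then have "k = 0 \<or> k = 1" by auto
  then show "lower_adj (arc m i j \<circ> f) k = lower_adj (arc n (lower_adj f i) (lower_adj f j)) k"
    unfolding lower_adj_comp[OF f arc_lambda_map]
    using lower_adj_arc[OF ij] lower_adj_arc[OF lower_adj_le[OF f ij]] by auto
qed (rule arc_lambda_map)

definition arc3 :: "nat \<Rightarrow> int \<Rightarrow> int \<Rightarrow> int \<Rightarrow> int \<Rightarrow> int" where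
  "arc3 n c d e y =
     (y - c) div (int n + 1) + (y - d) div (int n + 1) + (y - e) div (int n + 1) + 2"

lemma arc3_lambda_map: "arc3 n c d e \<in> lambda_map n 2"
proof -
  have "arc3 n c d e (x + int n + 1) = arc3 n c d e x + int 2 + 1" for x
    using div_shift1[of "x - c" n] div_shift1[of "x - d" n] div_shift1[of "x - e" n]
    by (simp add: arc3_def algebra_simps)
  moreover have "mono (arc3 n c d e)"
    by (auto simp: mono_def arc3_def intro!: add_mono zdiv_mono1)
  ultimately show ?thesis by (simp add: lambda_map_def)
qed

lemma lower_adj_arc3:
  assumes "c \<le> d" "d \<le> e" "e \<le> c + int n + 1"
  shows "lower_adj (arc3 n c d e) 0 = c" "lower_adj (arc3 n c d e) 1 = d"
    "lower_adj (arc3 n c d e) 2 = e"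
proof -
  have ge: "x div (int n + 1) \<ge> -1" if "- int n - 1 \<le> x" for x
    using zdiv_mono1[of "- int n - 1" x "int n + 1"] div_unit[of "-1" n "-int n - 1"] that by simp
  have lt: "x div (int n + 1) \<le> -1" if "x < 0" for x
    using zdiv_mono1[of x "-1" "int n + 1"] div_unit[of "-1" n "-1"] that by simp
  have ge0: "x div (int n + 1) \<ge> 0" if "0 \<le> x" for x
    using that by (simp add: pos_imp_zdiv_nonneg_iff)
  have le0: "x div (int n + 1) \<le> 0" if "x \<le> int n" for x
    using zdiv_mono1[of x "int n" "int n + 1"] that by simp
  have 5: "(-1) div (int n + 1) = -1" using div_unit[of "-1" n "-1"] by simp
  show "lower_adj (arc3 n c d e) 0 = c"
    by (rule lower_adj_eqI[OF arc3_lambda_map])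
      (use ge[of "c - d"] ge[of "c - e"] lt[of "c - 1 - d"] lt[of "c - 1 - e"] 5 assms
        in \<open>auto simp: arc3_def\<close>)
  show "lower_adj (arc3 n c d e) 1 = d"
    by (rule lower_adj_eqI[OF arc3_lambda_map])
      (use ge0[of "d - c"] ge[of "d - e"] le0[of "d - 1 - c"] lt[of "d - 1 - e"] 5 assms
        in \<open>auto simp: arc3_def\<close>)
  show "lower_adj (arc3 n c d e) 2 = e"
    by (rule lower_adj_eqI[OF arc3_lambda_map])
      (use ge0[of "e - c"] ge0[of "e - d"] le0[of "e - 1 - c"] le0[of "e - 1 - d"] 5 assms
        in \<open>auto simp: arc3_def\<close>)
qed

section \<open>Classes of cyclic maps and the simplicial maps among them\<close>

lemma lambda_class_in_hom: "f \<in> lambda_map n m \<Longrightarrow> lambda_class n m f \<in> lambda_hom n m"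
  by (auto simp: lambda_hom_def lambda_class_def quotient_def)

lemma lambda_homE:
  assumes "F \<in> lambda_hom n m"
  obtains f where "f \<in> lambda_map n m" "F = lambda_class n m f"
  using assms by (auto simp: lambda_hom_def lambda_class_def quotient_def)

lemma lambda_comp_in_hom:
  assumes "F \<in> lambda_hom n m" "G \<in> lambda_hom m p"
  shows "lambda_comp G F \<in> lambda_hom n p"
  by (metis assms lambda_homE lambda_comp_class lambda_class_in_hom lambda_map_comp)

lemma lambda_map_id: "id \<in> lambda_map n n"
  by (auto simp: lambda_map_def mono_def)

lemma lambda_class_shift:
  assumes f: "f \<in> lambda_map n m"
  shows "lambda_class n m (\<lambda>x. f x + k * (int m + 1)) = lambda_class n m f"
proof -
  have g: "(\<lambda>x. f x + k * (int m + 1)) \<in> lambda_map n m"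
    using f by (auto simp: lambda_map_def mono_def)
  have *: "f x + k * (int m + 1) + l * (int m + 1) = f x + (k + l) * (int m + 1)" for x l
    by (simp add: algebra_simps)
  show ?thesis
    unfolding lambda_class_eq[OF f] lambda_class_eq[OF g] *
    by (auto, metis add_diff_cancel_left' add.commute diff_add_cancel)
qed

text \<open>Meant for \<open>f\<close> with \<open>lower_adj f 0 = 0\<close>, that is, f(-1) < 0 <=
  f(0). Periodicity then forces \<open>f\<close> to send [n] into [m], so its class comes from a
  simplicial map.\<close>

definition delta_part :: "nat \<Rightarrow> (int \<Rightarrow> int) \<Rightarrow> nat \<Rightarrow> nat" where
  "delta_part n f = (\<lambda>i\<in>{..n}. nat (f (int i)))"

context
  fixes n m :: nat and f
  assumes f: "f \<in> lambda_map n m" and f0: "lower_adj f 0 = 0"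
begin

lemma delta_part_bounds: "0 \<le> x \<Longrightarrow> 0 \<le> f x" "x \<le> int n \<Longrightarrow> f x \<le> int m"
proof -
  have mono: "x \<le> y \<Longrightarrow> f x \<le> f y" for x y
    using f by (auto simp: lambda_map_def mono_def)
  have "0 \<le> f 0" "f (-1) < 0"
    using lower_adj_iff[OF f, of 0 0] lower_adj_iff[OF f, of 0 "-1"] f0 by simp_all
  moreover have "f (int n) = f (-1) + int m + 1"
    using lambda_map_shift[OF f, of "-1" 1] by simp
  ultimately show "0 \<le> x \<Longrightarrow> 0 \<le> f x" "x \<le> int n \<Longrightarrow> f x \<le> int m"
    using mono[of 0 x] mono[of x "int n"] by simp_all
qed

lemma delta_part_hom: "delta_part n f \<in> delta_hom n m"
  using delta_part_bounds f by (auto simp: delta_part_def delta_hom_def mono_on_def lambda_map_def mono_def nat_le_iff)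

lemma delta_part_class: "delta_to_lambda n m (delta_part n f) = lambda_class n m f"
proof -
  have "int (delta_part n f (nat (y mod (int n + 1)))) + y div (int n + 1) * (int m + 1) = f y" for y
  proof -
    have r: "0 \<le> y mod (int n + 1)" "y mod (int n + 1) \<le> int n"
      using pos_mod_sign[of "int n + 1" y] pos_mod_bound[of "int n + 1" y] by auto
    then have "int (delta_part n f (nat (y mod (int n + 1)))) = f (y mod (int n + 1))"
      using delta_part_bounds(1) by (auto simp: delta_part_def nat_le_iff)
    then show ?thesis
      using lambda_map_shift[OF f, of "y mod (int n + 1)" "y div (int n + 1)"]
      unfolding mod_div_mult_eq by simp
  qed
  then show ?thesis by (simp add: delta_to_lambda_def)
qed

text \<open>Both sides describe the first position at which \<open>f\<close> reaches
  \<open>j\<close>, once among natural numbers with a default value and once among integers.\<close>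

lemma delta_part_dual:
  assumes "j \<le> m + 1"
  shows "dual_map n (delta_part n f) j = nat (lower_adj f (int j))"
proof -
  let ?a = "lower_adj f (int j)"
  have a: "0 \<le> ?a" "?a \<le> int n + 1"
    using lower_adj_mono[OF f, of 0 "int j"] lower_adj_mono[OF f, of "int j" "int m + 1"]
      lower_adj_shift[OF f, of 0 1] f0 assms by simp_all
  have iff: "j \<le> delta_part n f i \<longleftrightarrow> ?a \<le> int i" if "i \<le> n" for i
    using that delta_part_bounds(1)[of "int i"] by (auto simp: delta_part_def lower_adj_iff[OF f])
  show ?thesis
  proof (cases "?a \<le> int n")
    case True
    then have "(LEAST i. i \<le> n \<and> j \<le> delta_part n f i) = nat ?a"
      using a iff by (intro Least_equality) auto
    moreover have "\<exists>i\<le>n. j \<le> delta_part n f i"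
      using True a iff by (intro exI[of _ "nat ?a"]) auto
    ultimately show ?thesis by (simp add: dual_map_def)
  next
    \<comment> \<open>Here the adjoint equals \<open>n + 1\<close>, the default value of
      \<open>dual_map\<close>.\<close>
    case False
    then show ?thesis using a iff by (auto simp: dual_map_def)
  qed
qed

end

text \<open>The representative used in \<open>delta_to_lambda\<close>, named so that its adjoint can
  be computed.\<close>

definition delta_lift :: "nat \<Rightarrow> nat \<Rightarrow> (nat \<Rightarrow> nat) \<Rightarrow> int \<Rightarrow> int" where
  "delta_lift n m f y = int (f (nat (y mod (int n + 1)))) + (y div (int n + 1)) * (int m + 1)"

lemma delta_lift_lambda_map:
  assumes "f \<in> delta_hom n m"
  shows "delta_lift n m f \<in> lambda_map n m"
proof -
  have f: "f i \<le> m" "i \<le> j \<Longrightarrow> f i \<le> f j" if "i \<le> n" "j \<le> n" for i j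
    using assms that by (auto simp: delta_hom_def mono_on_def)
  have r: "nat (y mod (int n + 1)) \<le> n" for y
    using pos_mod_bound[of "int n + 1" y] by simp
  have "delta_lift n m f x \<le> delta_lift n m f y" if "x \<le> y" for x y
  proof (cases "x div (int n + 1) = y div (int n + 1)")
    case True
    then have "x mod (int n + 1) \<le> y mod (int n + 1)"
      using that by (simp add: minus_div_mult_eq_mod[symmetric])
    then show ?thesis
      using True f(2)[OF r[of x] r[of y]] by (simp add: delta_lift_def nat_mono)
  next
    \<comment> \<open>The values of \<open>f\<close> stay below \<open>m + 1\<close>, so a later
      period starts above everything in an earlier one.\<close>
    case False
    then have "x div (int n + 1) + 1 \<le> y div (int n + 1)"
      using zdiv_mono1[OF that, of "int n + 1"] by simp
    then have "(x div (int n + 1) + 1) * (int m + 1) \<le> y div (int n + 1) * (int m + 1)"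
      by (rule mult_right_mono) simp
    then show ?thesis
      using f(1)[OF r[of x] r[of x]] by (simp add: delta_lift_def algebra_simps)
  qed
  moreover have "delta_lift n m f (x + int n + 1) = delta_lift n m f x + int m + 1" for x
    using div_shift1[of x n] mod_add_self2[of x "int n + 1"]
    by (simp add: delta_lift_def algebra_simps)
  ultimately show ?thesis by (simp add: lambda_map_def mono_def)
qed

lemma delta_to_lambda_in_hom: "f \<in> delta_hom n m \<Longrightarrow> delta_to_lambda n m f \<in> lambda_hom n m"
  using lambda_class_in_hom[OF delta_lift_lambda_map, of f n m]
  by (simp add: delta_to_lambda_def delta_lift_def[abs_def])

text \<open>The lift sends 0 to the first nonnegative value and \<open>delta_part\<close> undoes it,
  so \<open>delta_part_dual\<close> applies.\<close>

lemma lower_adj_delta_lift: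
  assumes f: "f \<in> delta_hom n m" and "j \<le> m + 1"
  shows "lower_adj (delta_lift n m f) (int j) = int (dual_map n f j)"
proof -
  note L = delta_lift_lambda_map[OF f]
  have "(-1) div (int n + 1) = -1" using div_unit[of "-1" n "-1"] by simp
  moreover have "f (nat ((-1) mod (int n + 1))) \<le> m"
    using f pos_mod_bound[of "int n + 1" "-1"] by (auto simp: delta_hom_def)
  ultimately have a0: "lower_adj (delta_lift n m f) 0 = 0"
    by (intro lower_adj_eqI[OF L]) (auto simp: delta_lift_def)
  have "delta_part n (delta_lift n m f) = f"
  proof (rule extensionalityI)
    show "f \<in> extensional {..n}" using f by (simp add: delta_hom_def PiE_def)
  qed (auto simp: delta_part_def delta_lift_def)
  then have "dual_map n f j = nat (lower_adj (delta_lift n m f) (int j))"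
    using delta_part_dual[OF L a0 assms(2)] by simp
  then show ?thesis
    using lower_adj_mono[OF L, of 0 "int j"] a0 by simp
qed

subsection \<open>The difference function of a cyclic structure\<close>

lemma interval_objD:
  assumes "\<beta> \<in> interval_obj I b t n"
  shows "\<beta> 0 = b" "\<beta> (n+1) = t" "\<And>i. i \<le> n+1 \<Longrightarrow> \<beta> i \<in> I"
    "\<And>i j. i \<le> j \<Longrightarrow> j \<le> n+1 \<Longrightarrow> \<beta> i \<le> \<beta> j" "\<beta> \<in> extensional {..n+1}"
  using assms by (auto simp: interval_obj_def mono_on_def PiE_def)

lemma interval_obj_eqI:
  assumes "\<beta> \<in> interval_obj I b t n" "\<gamma> \<in> interval_obj I b t n"
    and "\<And>j. 1 \<le> j \<Longrightarrow> j \<le> n \<Longrightarrow> \<beta> j = \<gamma> j"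
  shows "\<beta> = \<gamma>"
proof (rule extensionalityI)
  show "\<beta> \<in> extensional {..n+1}" "\<gamma> \<in> extensional {..n+1}"
    using assms interval_objD(5) by blast+
  fix j assume "j \<in> {..n+1}"
  then have "j = 0 \<or> j = n + 1 \<or> 1 \<le> j \<and> j \<le> n" by auto
  then show "\<beta> j = \<gamma> j"
    using assms interval_objD(1,2) by metis
qed

text \<open>Endpoints being fixed, the elements over [1], [2] and [3] are given by one, two and
  three ordered interior entries.\<close>

definition seq1 :: "'a \<Rightarrow> 'a \<Rightarrow> 'a \<Rightarrow> nat \<Rightarrow> 'a" where
  "seq1 b t u = (\<lambda>j\<in>{..2}. if j = 0 then b else if j = 1 then u else t)"

definition seq2 :: "'a \<Rightarrow> 'a \<Rightarrow> 'a \<Rightarrow> 'a \<Rightarrow> nat \<Rightarrow> 'a" where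
  "seq2 b t u v = (\<lambda>j\<in>{..3}. if j = 0 then b else if j = 1 then u else if j = 2 then v else t)"

definition seq3 :: "'a \<Rightarrow> 'a \<Rightarrow> 'a \<Rightarrow> 'a \<Rightarrow> 'a \<Rightarrow> nat \<Rightarrow> 'a" where
  "seq3 b t u v w = (\<lambda>j\<in>{..4}. if j = 0 then b else if j = 1 then u else if j = 2 then v
     else if j = 3 then w else t)"

section \<open>Values of a cyclic structure on arcs\<close>

locale cyclic_structure =
  fixes I :: "'a::linorder set" and b t :: 'a and Fo Fm
  assumes interval: "order_interval I b t"
    and cyclic: "(Fo, Fm) \<in> cyclic_structures I b t"
begin

lemma bounds: "b \<in> I" "t \<in> I" "x \<in> I \<Longrightarrow> b \<le> x" "x \<in> I \<Longrightarrow> x \<le> t"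
  using interval by (auto simp: order_interval_def)

lemma seq1_in: "u \<in> I \<Longrightarrow> seq1 b t u \<in> interval_obj I b t 1"
  by (auto simp: interval_obj_def seq1_def mono_on_def bounds split: if_splits)

lemma seq2_in: "u \<in> I \<Longrightarrow> v \<in> I \<Longrightarrow> u \<le> v \<Longrightarrow> seq2 b t u v \<in> interval_obj I b t 2"
  by (auto simp: interval_obj_def seq2_def mono_on_def bounds)

lemma seq3_in:
  "u \<in> I \<Longrightarrow> v \<in> I \<Longrightarrow> w \<in> I \<Longrightarrow> u \<le> v \<Longrightarrow> v \<le> w \<Longrightarrow> seq3 b t u v w \<in> interval_obj I b t 3"
  by (auto simp: interval_obj_def seq3_def mono_on_def bounds)

lemma is_functor: "lambda_functor (Fo, Fm)" and obj: "Fo n = interval_obj I b t n"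
  and extends: "f \<in> delta_hom n m \<Longrightarrow> Fm n m (delta_to_lambda n m f) = interval_mor I b t n m f"
  using cyclic by (auto simp: cyclic_structures_def)

lemma Fm_in: "Fm n m \<in> lambda_hom n m \<rightarrow>\<^sub>E (Fo n \<rightarrow>\<^sub>E Fo m)"
  using is_functor by (simp add: lambda_functor_def)

definition act :: "nat \<Rightarrow> nat \<Rightarrow> (int \<Rightarrow> int) \<Rightarrow> (nat \<Rightarrow> 'a) \<Rightarrow> nat \<Rightarrow> 'a" where
  "act n m f \<beta> = Fm n m (lambda_class n m f) \<beta>"

lemma act_in:
  assumes "f \<in> lambda_map n m" "\<beta> \<in> interval_obj I b t n"
  shows "act n m f \<beta> \<in> interval_obj I b t m"
proof -
  have "Fm n m (lambda_class n m f) \<in> Fo n \<rightarrow>\<^sub>E Fo m"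
    using Fm_in lambda_class_in_hom[OF assms(1)] by (rule PiE_mem)
  then show ?thesis using assms(2) by (auto simp: act_def obj)
qed

lemma act_comp:
  assumes "f \<in> lambda_map n m" "g \<in> lambda_map m p" "\<beta> \<in> interval_obj I b t n"
  shows "act m p g (act n m f \<beta>) = act n p (g \<circ> f) \<beta>"
proof -
  have "Fm n p (lambda_comp (lambda_class m p g) (lambda_class n m f)) =
      compose (Fo n) (Fm m p (lambda_class m p g)) (Fm n m (lambda_class n m f))"
    using is_functor lambda_class_in_hom assms(1,2) by (auto simp: lambda_functor_def)
  then show ?thesis
    using assms(3) by (simp add: act_def lambda_comp_class[OF assms(1,2)] obj compose_eq)
qed

lemma act_shift:
  "f \<in> lambda_map n m \<Longrightarrow> act n m (\<lambda>x. f x + k * (int m + 1)) \<beta> = act n m f \<beta>"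
  by (simp add: act_def lambda_class_shift)

text \<open>The normalisation at 0 makes the class of \<open>f\<close> simplicial, where the functor
  is prescribed and reindexes by the dual map.\<close>

lemma act_delta:
  assumes "f \<in> lambda_map n m" "lower_adj f 0 = 0" "\<beta> \<in> interval_obj I b t n" "j \<le> m + 1"
  shows "act n m f \<beta> j = \<beta> (nat (lower_adj f (int j)))"
  using extends[OF delta_part_hom[OF assms(1,2)]] assms(3,4)
  by (simp add: act_def delta_part_class[OF assms(1,2)] interval_mor_def delta_part_dual[OF assms(1,2)])

text \<open>
  Reading \<open>\<beta>\<close> as the \<open>n+1\<close> cut points \<open>\<beta> 0, \<dots>, \<beta> n\<close> of a circle, this is the length of the arc from
  cut \<open>c\<close> to cut \<open>d\<close>, expressed as an element of \<open>I\<close> by moving its origin to the base point.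
\<close>

definition arc_val :: "nat \<Rightarrow> int \<Rightarrow> int \<Rightarrow> (nat \<Rightarrow> 'a) \<Rightarrow> 'a" where
  "arc_val n c d \<beta> = act n 1 (arc n c d) \<beta> 1"

lemma arc_val_in: "\<beta> \<in> interval_obj I b t n \<Longrightarrow> arc_val n c d \<beta> \<in> I"
  unfolding arc_val_def by (intro interval_objD(3)[OF act_in[OF arc_lambda_map]]) auto

lemma arc_val_act:
  assumes "f \<in> lambda_map n m" "\<beta> \<in> interval_obj I b t n" "i \<le> j" "j \<le> i + int m + 1"
  shows "arc_val m i j (act n m f \<beta>) = arc_val n (lower_adj f i) (lower_adj f j) \<beta>"
  using act_comp[OF assms(1) arc_lambda_map assms(2), of i j] arc_comp[OF assms(1,3,4)]
  by (simp add: arc_val_def)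

lemma arc_val_0:
  assumes "\<beta> \<in> interval_obj I b t n" "j \<le> n + 1"
  shows "arc_val n 0 (int j) \<beta> = \<beta> j"
  using act_delta[OF arc_lambda_map _ assms(1), of 0 "int j" 1] lower_adj_arc[of 0 "int j" n] assms(2)
  by (simp add: arc_val_def)

text \<open>Moving both cuts by \<open>k\<close> full turns changes \<open>arc\<close> by a multiple
  of 2, hence not its class as a morphism to [1].\<close>

lemma arc_val_shift:
  "arc_val n (c + k * (int n + 1)) (d + k * (int n + 1)) \<beta> = arc_val n c d \<beta>"
proof -
  have "(x - (a + k * (int n + 1))) div (int n + 1) = (x - a) div (int n + 1) - k" for x a
    using div_mult_self1[of "int n + 1" "x - a" "- k"] by (simp add: algebra_simps)
  then have "arc n (c + k * (int n + 1)) (d + k * (int n + 1))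
      = (\<lambda>x. arc n c d x + (- k) * (int 1 + 1))"
    by (simp add: arc_def fun_eq_iff)
  then show ?thesis
    using act_shift[OF arc_lambda_map, of n c d "- k" \<beta>] by (simp only: arc_val_def)
qed

text \<open>The \<open>j\<close>-th entry of the image is its arc from cut 0 to cut
  \<open>j\<close>, and arcs pull back along \<open>f\<close> by the adjoint. Thus the arc values
  determine the whole structure.\<close>

lemma act_coord:
  assumes "f \<in> lambda_map n m" "\<beta> \<in> interval_obj I b t n" "j \<le> m + 1"
  shows "act n m f \<beta> j = arc_val n (lower_adj f 0) (lower_adj f (int j)) \<beta>"
  using arc_val_act[OF assms(1,2), of 0 "int j"] arc_val_0[OF act_in[OF assms(1,2)] assms(3)] assms(3)
  by simp

lemma arc_val_trivial:
  assumes "\<beta> \<in> interval_obj I b t n"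
  shows "arc_val n c c \<beta> = b" "arc_val n c (c + int n + 1) \<beta> = t"
proof -
  \<comment> \<open>A map to [0] jumping at \<open>c\<close>. The only element over [0] is the
    sequence \<open>b\<close>, \<open>t\<close>, so both of its entries are known.\<close>
  define f where "f = (\<lambda>y. (y - c) div (int n + 1))"
  have f: "f \<in> lambda_map n 0"
    using div_shift1[of "x - c" n for x]
    by (auto simp: lambda_map_def f_def mono_def algebra_simps intro!: zdiv_mono1)
  have a0: "lower_adj f 0 = c"
    by (rule lower_adj_eqI[OF f]) (use div_unit[of "-1" n "-1"] in \<open>auto simp: f_def\<close>)
  have a1: "lower_adj f 1 = c + int n + 1"
    using lower_adj_shift[OF f, of 0 1] a0 by simp
  note in0 = act_in[OF f assms]
  show "arc_val n c c \<beta> = b"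
    using act_coord[OF f assms, of 0] interval_objD(1)[OF in0] a0 by simp
  show "arc_val n c (c + int n + 1) \<beta> = t"
    using act_coord[OF f assms, of 1] interval_objD(2)[OF in0] a0 a1 by simp
qed

text \<open>In the left-ordered group attached to the cyclic structure, this is \<open>u\<inverse>v\<close>.\<close>

definition rho :: "'a \<Rightarrow> 'a \<Rightarrow> 'a" where
  "rho u v = arc_val 2 1 2 (seq2 b t u v)"

text \<open>The three cuts define a map to [2] whose image has \<open>arc_val n c d\<close> and
  \<open>arc_val n c e\<close> as interior entries. Monotonicity of that sequence gives the first
  claim, and its arc from 1 to 2 gives the second.\<close>

lemma arc_val_le:
  assumes "\<beta> \<in> interval_obj I b t n" "c \<le> d" "d \<le> e" "e \<le> c + int n + 1"
  shows "arc_val n c d \<beta> \<le> arc_val n c e \<beta>"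
    and "rho (arc_val n c d \<beta>) (arc_val n c e \<beta>) = arc_val n d e \<beta>"
proof -
  let ?f = "arc3 n c d e"
  let ?\<gamma> = "act n 2 ?f \<beta>"
  note adj = lower_adj_arc3[OF assms(2-4)]
  have in2: "?\<gamma> \<in> interval_obj I b t 2"
    by (rule act_in[OF arc3_lambda_map assms(1)])
  have 1: "?\<gamma> 1 = arc_val n c d \<beta>" and 2: "?\<gamma> 2 = arc_val n c e \<beta>"
    using act_coord[OF arc3_lambda_map[of n c d e] assms(1), of 1]
      act_coord[OF arc3_lambda_map[of n c d e] assms(1), of 2] adj by simp_all
  show le: "arc_val n c d \<beta> \<le> arc_val n c e \<beta>"
    using interval_objD(4)[OF in2, of 1 2] 1 2 by simp
  have "?\<gamma> = seq2 b t (arc_val n c d \<beta>) (arc_val n c e \<beta>)"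
  proof (rule interval_obj_eqI[OF in2 seq2_in])
    fix j :: nat assume "1 \<le> j" "j \<le> 2"
    then have "j = 1 \<or> j = 2" by auto
    then show "?\<gamma> j = seq2 b t (arc_val n c d \<beta>) (arc_val n c e \<beta>) j"
      using 1 2 by (auto simp: seq2_def)
  qed (use le arc_val_in assms(1) in auto)
  then show "rho (arc_val n c d \<beta>) (arc_val n c e \<beta>) = arc_val n d e \<beta>"
    using arc_val_act[OF arc3_lambda_map[of n c d e] assms(1), of 1 2] adj by (simp add: rho_def)
qed

lemma arc_val_rho:
  assumes \<beta>: "\<beta> \<in> interval_obj I b t n" and "c \<le> d" "d \<le> n + 1"
  shows "arc_val n (int c) (int d) \<beta> = rho (\<beta> c) (\<beta> d)"
  using arc_val_le(2)[OF \<beta>, of 0 "int c" "int d"] arc_val_0[OF \<beta>] assms(2,3) by simp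

text \<open>Seen from cut \<open>d\<close>, the arc runs from \<open>c\<close> to the end of the
  full turn, whose value is \<open>t\<close>.\<close>

lemma arc_val_wrap:
  assumes \<beta>: "\<beta> \<in> interval_obj I b t n" and "d \<le> c" "c \<le> n + 1"
  shows "arc_val n (int c) (int d + int n + 1) \<beta> = rho (rho (\<beta> d) (\<beta> c)) t"
  using arc_val_le(2)[OF \<beta>, of "int d" "int c" "int d + int n + 1"]
    arc_val_trivial(2)[OF \<beta>] arc_val_rho[OF assms] assms(2,3) by simp

section \<open>Algebraic laws of \<open>rho\<close>\<close>

context
  fixes u v
  assumes uv: "u \<in> I" "v \<in> I" "u \<le> v"
begin

text \<open>A turn has three cuts here, so cuts 3 and 4 are cuts 0 and 1 one turn later.\<close>

lemma seq2_arcs: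
  "arc_val 2 1 2 (seq2 b t u v) = rho u v"
  "arc_val 2 1 3 (seq2 b t u v) = rho u t"
  "arc_val 2 2 3 (seq2 b t u v) = rho v t"
  "arc_val 2 2 4 (seq2 b t u v) = rho (rho u v) t"
  "arc_val 2 3 4 (seq2 b t u v) = u"
  using arc_val_rho[OF seq2_in[OF uv], of 1 2] arc_val_rho[OF seq2_in[OF uv], of 1 3]
    arc_val_rho[OF seq2_in[OF uv], of 2 3] arc_val_wrap[OF seq2_in[OF uv], of 1 2]
    arc_val_shift[of 2 0 1 1 "seq2 b t u v"] arc_val_0[OF seq2_in[OF uv], of 1]
  by (simp_all add: seq2_def)

lemma rho_in: "rho u v \<in> I"
  unfolding rho_def by (rule arc_val_in[OF seq2_in[OF uv]])

text \<open>Cuts 2, 3, 4 of the sequence with interior entries \<open>u\<close>, \<open>v\<close>: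
  the arc from 3 to 4 is \<open>u\<close>. So \<open>u\<close> is recovered from \<open>v\<close>
  and \<open>rho u v\<close>, which yields injectivity in the first argument.\<close>

lemma rho_fst: "u = rho (rho v t) (rho (rho u v) t)"
  using arc_val_le(2)[OF seq2_in[OF uv], of 2 3 4] seq2_arcs by simp

lemma rho_self: "rho u u = b"
  using arc_val_rho[OF seq2_in[OF uv], of 1 1] arc_val_trivial(1)[OF seq2_in[OF uv], of 1]
  by (simp add: seq2_def)

lemma rho_b: "rho b v = v"
  using arc_val_rho[OF seq2_in[OF uv], of 0 2] arc_val_0[OF seq2_in[OF uv], of 2]
  by (simp add: seq2_def)

end

text \<open>This is \<open>rho_fst\<close> at \<open>v = t\<close>, where \<open>rho t t = b\<close>
  acts as a unit.\<close>

lemma rho_invol: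
  assumes "u \<in> I" shows "rho (rho u t) t = u"
proof -
  have "rho u t \<in> I" by (rule rho_in[OF assms bounds(2) bounds(4)[OF assms]])
  from rho_in[OF this bounds(2) bounds(4)[OF this]]
  have r: "rho (rho u t) t \<in> I" .
  from rho_b[OF bounds(1) r bounds(3)[OF r]]
  have "rho b (rho (rho u t) t) = rho (rho u t) t" .
  then show ?thesis
    using rho_fst[OF assms bounds(2) bounds(4)[OF assms]] rho_self[OF bounds(2) bounds(2) order.refl]
    by metis
qed

context
  fixes u v w
  assumes uvw: "u \<in> I" "v \<in> I" "w \<in> I" "u \<le> v" "v \<le> w"
begin

lemma seq3_arcs:
  "arc_val 3 1 2 (seq3 b t u v w) = rho u v"
  "arc_val 3 1 3 (seq3 b t u v w) = rho u w"
  "arc_val 3 2 3 (seq3 b t u v w) = rho v w"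
  using arc_val_rho[OF seq3_in[OF uvw], of 1 2] arc_val_rho[OF seq3_in[OF uvw], of 1 3]
    arc_val_rho[OF seq3_in[OF uvw], of 2 3] 
  by (simp_all add: seq3_def)

lemma rho_mono_snd: "rho u v \<le> rho u w"
  using arc_val_le(1)[OF seq3_in[OF uvw], of 1 2 3] seq3_arcs by simp

lemma rho_rho: "rho (rho u v) (rho u w) = rho v w"
  using arc_val_le(2)[OF seq3_in[OF uvw], of 1 2 3] seq3_arcs by simp

end

lemma rho_inj_fst:
  assumes "u \<in> I" "u' \<in> I" "w \<in> I" "u \<le> w" "u' \<le> w" "rho u w = rho u' w"
  shows "u = u'"
  using rho_fst[OF assms(1,3,4)] rho_fst[OF assms(2,3,5)] assms(6) by metis

lemma rho_onto_snd:
  assumes "u \<in> I" "s \<in> I" "s \<le> rho u t"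
  shows "\<exists>v\<in>I. u \<le> v \<and> rho u v = s"
proof -
  have r: "rho u t \<in> I" using rho_in assms bounds by auto
  \<comment> \<open>With these entries the arc from cut 2 to cut 3 is \<open>u\<close> and the arc
    from 3 to 4 is \<open>s\<close>. The arc from 2 to 4 is therefore the required
    \<open>v\<close>.\<close>
  let ?\<gamma> = "seq2 b t s (rho u t)"
  note \<gamma> = seq2_in[OF assms(2) r assms(3)] and arcs = seq2_arcs[OF assms(2) r assms(3)]
  have "u \<le> arc_val 2 2 4 ?\<gamma>"
    using arc_val_le(1)[OF \<gamma>, of 2 3 4] arcs rho_invol[OF assms(1)] by simp
  moreover have "rho u (arc_val 2 2 4 ?\<gamma>) = s"
    using arc_val_le(2)[OF \<gamma>, of 2 3 4] arcs rho_invol[OF assms(1)] by simp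
  ultimately show ?thesis using arc_val_in[OF \<gamma>] by blast
qed

lemma rho_onto_fst:
  assumes "w \<in> I" "s \<in> I" "s \<le> w" "rho w t \<le> rho s t"
  shows "\<exists>p\<in>I. p \<le> w \<and> rho p w = s"
proof -
  have r: "rho w t \<in> I" "rho s t \<in> I" using rho_in assms bounds by auto
  \<comment> \<open>By the involution the arcs from cuts 1 and 2 to cut 3 are \<open>w\<close> and
    \<open>s\<close>, so the arc from 1 to 2 is the required \<open>p\<close>.\<close>
  let ?\<gamma> = "seq2 b t (rho w t) (rho s t)"
  note \<gamma> = seq2_in[OF r assms(4)] and arcs = seq2_arcs[OF r assms(4)]
  have "arc_val 2 1 2 ?\<gamma> \<le> w"
    using arc_val_le(1)[OF \<gamma>, of 1 2 3] arcs rho_invol[OF assms(1)] by simp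
  moreover have "rho (arc_val 2 1 2 ?\<gamma>) w = s"
    using arc_val_le(2)[OF \<gamma>, of 1 2 3] arcs rho_invol[OF assms(1)] rho_invol[OF assms(2)] by simp
  ultimately show ?thesis using arc_val_in[OF \<gamma>] by blast
qed

end

subsection \<open>Upper bound on the number of structures\<close>

text \<open>Morphisms are determined by arc values, and these by \<open>rho\<close>: directly when
  the arc stays within a turn, through \<open>arc_val_wrap\<close> otherwise.\<close>

lemma cyclic_structure_eqI:
  assumes A: "cyclic_structure I b t Fo Fm" and B: "cyclic_structure I b t Fo' Fm'"
    and eq: "\<And>u v. u \<in> I \<Longrightarrow> v \<in> I \<Longrightarrow> u \<le> v \<Longrightarrow>
      cyclic_structure.rho b t Fm u v = cyclic_structure.rho b t Fm' u v"
  shows "(Fo, Fm) = (Fo', Fm')"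
proof -
  interpret A: cyclic_structure I b t Fo Fm by (rule A)
  interpret B: cyclic_structure I b t Fo' Fm' by (rule B)
  have arc: "A.arc_val n c d \<beta> = B.arc_val n c d \<beta>"
    if \<beta>: "\<beta> \<in> interval_obj I b t n" and cd: "c \<le> d" "d \<le> c + int n + 1" for n c d \<beta>
  proof -
    \<comment> \<open>Full turns are removed so that the arc starts at one of the cuts 0, ...,
      n.\<close>
    define N k c0 d0 where "N = int n + 1" and "k = c div N" and "c0 = c mod N" and "d0 = d - k * N"
    have c0: "0 \<le> c0" "c0 \<le> int n"
      using pos_mod_sign[of "int n + 1" c] pos_mod_bound[of "int n + 1" c]
      by (auto simp: c0_def N_def)
    have c: "c = c0 + k * N" and d: "d = d0 + k * N"
      by (simp_all only: c0_def k_def d0_def mod_div_mult_eq diff_add_cancel)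
    have cd0: "c0 \<le> d0" "d0 \<le> c0 + int n + 1" using cd c d by simp_all
    have in_I: "\<beta> i \<in> I" if "i \<le> n + 1" for i
      using interval_objD(3)[OF \<beta> that] .
    have "A.arc_val n c0 d0 \<beta> = B.arc_val n c0 d0 \<beta>"
    proof (cases "d0 \<le> int n + 1")
      case True
      have "nat c0 \<le> nat d0" "nat d0 \<le> n + 1" using True cd0 c0 by auto
      then show ?thesis
        using A.arc_val_rho[OF \<beta>, of "nat c0" "nat d0"] B.arc_val_rho[OF \<beta>, of "nat c0" "nat d0"]
          eq[of "\<beta> (nat c0)" "\<beta> (nat d0)"] in_I interval_objD(4)[OF \<beta>, of "nat c0" "nat d0"] c0 cd0
        by simp
    next
      case False
      \<comment> \<open>The arc continues past cut \<open>n + 1\<close>; \<open>e\<close> is its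
        end, counted in the next turn.\<close>
      define e where "e = nat (d0 - int n - 1)"
      have e: "d0 = int e + int n + 1" "e \<le> nat c0" "nat c0 \<le> n + 1"
        using False cd0 c0 by (auto simp: e_def)
      have le: "\<beta> e \<le> \<beta> (nat c0)" using interval_objD(4)[OF \<beta>] e by blast
      have "A.rho (\<beta> e) (\<beta> (nat c0)) = B.rho (\<beta> e) (\<beta> (nat c0))"
        using eq in_I le e by simp
      moreover have "A.rho (\<beta> e) (\<beta> (nat c0)) \<in> I"
        using A.rho_in[OF _ _ le] in_I e by simp
      ultimately show ?thesis
        using A.arc_val_wrap[OF \<beta> e(2,3)] B.arc_val_wrap[OF \<beta> e(2,3)] c0 e(1)
          eq A.bounds by simp
    qed
    then show ?thesis
      unfolding c d N_def A.arc_val_shift B.arc_val_shift .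
  qed
  have act: "A.act n m f \<beta> = B.act n m f \<beta>"
    if f: "f \<in> lambda_map n m" and \<beta>: "\<beta> \<in> interval_obj I b t n" for n m f \<beta>
  proof (rule interval_obj_eqI[OF A.act_in[OF that] B.act_in[OF that]])
    fix j assume "1 \<le> j" "j \<le> m"
    then show "A.act n m f \<beta> j = B.act n m f \<beta> j"
      using A.act_coord[OF that, of j] B.act_coord[OF that, of j]
        arc[OF \<beta> lower_adj_le[OF f, of 0 "int j"]] by simp
  qed
  have obj: "Fo = Fo'" using A.obj B.obj by auto
  have "Fm n m F = Fm' n m F" for n m F
  proof (cases "F \<in> lambda_hom n m")
    case True
    then obtain f where f: "f \<in> lambda_map n m" "F = lambda_class n m f" by (rule lambda_homE)
    have "Fm n m F \<in> Fo n \<rightarrow>\<^sub>E Fo m" "Fm' n m F \<in> Fo n \<rightarrow>\<^sub>E Fo m"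
      using PiE_mem[OF A.Fm_in True] PiE_mem[OF B.Fm_in True] obj by simp_all
    then show ?thesis
      using act[OF f(1)] unfolding A.act_def B.act_def f(2) A.obj
      by (meson PiE_ext)
  next
    case False
    moreover have "Fm n m \<in> extensional (lambda_hom n m)" "Fm' n m \<in> extensional (lambda_hom n m)"
      using A.Fm_in B.Fm_in by (simp_all add: PiE_def)
    ultimately show ?thesis by (simp add: extensional_def)
  qed
  then have "Fm = Fm'" by (simp add: fun_eq_iff)
  then show ?thesis using obj by simp
qed

section \<open>The unit interval: monotonicity and rational data\<close>

locale unit_interval_cyclic = cyclic_structure "{0..1::real}" 0 1 Fo Fm for Fo Fm
begin

lemma rho_range: "0 \<le> u \<Longrightarrow> u \<le> v \<Longrightarrow> v \<le> 1 \<Longrightarrow> 0 \<le> rho u v \<and> rho u v \<le> 1"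
  using rho_in[of u v] by auto

text \<open>
  In a general left-ordered group this fails. Here a violation gives \<open>g = u\<inverse>v > 0\<close> and \<open>x\<close> with
  \<open>x \<le> g\<inverse>x\<close>; by completeness translation by \<open>g\<inverse>\<close> then has a fixed point, which forces \<open>g = 0\<close>.
\<close>

lemma rho_antimono_fst:
  assumes "0 \<le> u" "u \<le> v" "v \<le> w" "w \<le> 1"
  shows "rho v w \<le> rho u w"
proof (rule ccontr)
  assume "\<not> rho v w \<le> rho u w"
  define g x where "g = rho u v" and "x = rho u w"
  \<comment> \<open>By \<open>rho_rho\<close> the right-hand side is \<open>rho v w\<close>, which
    exceeds \<open>rho u w\<close> by assumption.\<close>
  have x: "x \<le> rho g x"
    using rho_rho[of u v w] assms \<open>\<not> _\<close> by (auto simp: g_def x_def)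
  have gx: "0 \<le> g" "g \<le> x" "x \<le> 1"
    using rho_mono_snd[of u v w] rho_range assms by (auto simp: g_def x_def)
  \<comment> \<open>Knaster-Tarski argument: \<open>rho g\<close> is monotone above
    \<open>x\<close>, and the supremum of the points it does not lower is a fixed point.\<close>
  define S where "S = {z \<in> {x..1}. z \<le> rho g z}"
  define p where "p = Sup S"
  have S: "x \<in> S" "bdd_above S" using x gx by (auto simp: S_def intro: bdd_aboveI)
  have upper: "z \<le> p" if "z \<in> S" for z unfolding p_def using cSup_upper[OF that S(2)] .
  have p: "x \<le> p" "p \<le> 1"
    using upper[OF S(1)] S(1) by (auto simp: p_def S_def intro!: cSup_least)
  have mono: "rho g y \<le> rho g z" if "x \<le> y" "y \<le> z" "z \<le> 1" for y z
    using rho_mono_snd[of g y z] that gx by auto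
  have "z \<le> rho g p" if "z \<in> S" for z
    using mono[of z p] upper[OF that] p that by (auto simp: S_def)
  then have "p \<le> rho g p"
    using cSup_least[of S "rho g p"] S(1) unfolding p_def by blast
  moreover from this have "rho g p \<in> S"
    using mono[of p "rho g p"] rho_range[of g p] p gx by (auto simp: S_def)
  ultimately have "rho g p = p"
    using upper by force
  also have "p = rho 0 p" using rho_b[of p p] p gx rho_b[of 0 p] by auto
  finally have "g = 0" using rho_inj_fst[of g 0 p] p gx by auto
  then have "rho u v = rho v v"
    using rho_self[of v v] assms by (auto simp: g_def)
  then have "u = v"
    using rho_inj_fst[of u v v] assms by auto
  with \<open>\<not> _\<close> show False by simp
qed

lemma rho_le_snd: "0 \<le> u \<Longrightarrow> u \<le> v \<Longrightarrow> v \<le> 1 \<Longrightarrow> rho u v \<le> v"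
  using rho_antimono_fst[of 0 u v] rho_b[of 0 v] by auto

end

text \<open>If the second structure had the larger value, some rational \<open>r\<close> would
  separate the two. Surjectivity, in place of continuity, lets \<open>u\<close> be raised and
  \<open>v\<close> lowered to rationals \<open>p\<close>, \<open>q\<close> while the second value
  stays above \<open>r\<close>. By monotonicity the first value only decreases, contradicting the
  comparison at \<open>p\<close>, \<open>q\<close>, \<open>r\<close>.\<close>

lemma rho_le_of_rational:
  assumes A: "unit_interval_cyclic Fo Fm" and B: "unit_interval_cyclic Fo' Fm'"
    and le: "\<And>p q s. p \<in> \<rat> \<Longrightarrow> q \<in> \<rat> \<Longrightarrow> s \<in> \<rat> \<Longrightarrow> 0 \<le> p \<Longrightarrow> p \<le> q \<Longrightarrow> q \<le> 1 \<Longrightarrow>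
      cyclic_structure.rho 0 1 Fm p q \<le> s \<Longrightarrow> cyclic_structure.rho 0 1 Fm' p q \<le> s"
    and uv: "0 \<le> u" "u \<le> v" "v \<le> 1"
  shows "cyclic_structure.rho 0 1 Fm' u v \<le> cyclic_structure.rho 0 1 Fm u v"
proof (rule ccontr)
  interpret A: unit_interval_cyclic Fo Fm by (rule A)
  interpret B: unit_interval_cyclic Fo' Fm' by (rule B)
  assume "\<not> B.rho u v \<le> A.rho u v"
  then obtain r where r: "r \<in> \<rat>" "A.rho u v < r" "r < B.rho u v"
    using Rats_dense_in_real[of "A.rho u v" "B.rho u v"] by auto
  define s where "s = (r + B.rho u v) / 2"
  have s: "r < s" "s < B.rho u v" using r by (auto simp: s_def field_simps)
  have r0: "0 < r" using A.rho_range[OF uv] r by simp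
  have sv: "s < v" using B.rho_le_snd[OF uv] s by simp
  \<comment> \<open>The level \<open>s\<close> lies strictly below the value at \<open>u\<close>, so
    antitonicity puts \<open>p'\<close> strictly above \<open>u\<close> and leaves room for a
    rational.\<close>
  obtain p' where p': "0 \<le> p'" "p' \<le> v" "B.rho p' v = s"
    using B.rho_onto_fst[of v s] B.rho_antimono_fst[of s v 1] s sv r0 uv by auto
  have "u < p'"
    using B.rho_antimono_fst[of p' u v] p' uv s by force
  then obtain p where p: "p \<in> \<rat>" "u < p" "p < p'"
    using Rats_dense_in_real by blast
  have p0: "0 \<le> p" "p \<le> v" using p uv p' by auto
  have ps: "s \<le> B.rho p v"
    using B.rho_antimono_fst[of p p' v] p p0 p' uv by auto
  \<comment> \<open>A second level between \<open>r\<close> and \<open>s\<close>, leaving room to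
    lower \<open>v\<close>.\<close>
  define r' where "r' = (r + s) / 2"
  have r': "r < r'" "r' < s" using s by (auto simp: r'_def field_simps)
  have "B.rho p v \<le> B.rho p 1" using B.rho_mono_snd[of p v 1] p0 uv by auto
  then obtain q' where q': "p \<le> q'" "q' \<le> 1" "B.rho p q' = r'"
    using B.rho_onto_snd[of p r'] r' ps p0 uv r0 B.rho_range[of p v] by auto
  have "q' < v"
    using B.rho_mono_snd[of p v q'] p0 uv q' r' ps by force
  then obtain q where q: "q \<in> \<rat>" "q' < q" "q < v"
    using Rats_dense_in_real by blast
  have "r' \<le> B.rho p q"
    using B.rho_mono_snd[of p q' q] q q' p0 uv by auto
  moreover have "A.rho p q \<le> r"
    using A.rho_mono_snd[of p q v] A.rho_antimono_fst[of u p v] p p0 q q' uv r by auto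
  ultimately show False
    using le[OF p(1) q(1) r(1)] p0 q q' uv r' by auto
qed

text \<open>Encodes a structure as a subset of a countable set, so that an injectivity statement
  bounds the cardinality by the continuum.\<close>

definition rational_graph :: "(nat \<Rightarrow> real) lambda_set \<Rightarrow> (rat \<times> rat \<times> rat) set" where
  "rational_graph S = {(p, q, s). 0 \<le> p \<and> p \<le> q \<and> q \<le> 1 \<and>
     cyclic_structure.rho 0 1 (snd S) (of_rat p) (of_rat q) \<le> of_rat s}"

lemma inj_on_rational_graph: "inj_on rational_graph (cyclic_structures {0..1::real} 0 1)"
proof (rule inj_onI)
  fix S S' assume SS': "S \<in> cyclic_structures {0..1::real} 0 1" "S' \<in> cyclic_structures {0..1::real} 0 1"
    and eq: "rational_graph S = rational_graph S'"
  obtain Fo Fm Fo' Fm' where S: "S = (Fo, Fm)" "S' = (Fo', Fm')" by (cases S, cases S')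
  have int: "order_interval {0..1::real} 0 1" by (simp add: order_interval_def)
  have A: "cyclic_structure {0..1} 0 1 Fo Fm" and B: "cyclic_structure {0..1} 0 1 Fo' Fm'"
    using SS' int by (simp_all add: S cyclic_structure_def)
  have A': "unit_interval_cyclic Fo Fm" and B': "unit_interval_cyclic Fo' Fm'"
    using A B by (simp_all add: unit_interval_cyclic_def)
  have iff: "cyclic_structure.rho 0 1 Fm p q \<le> s \<longleftrightarrow> cyclic_structure.rho 0 1 Fm' p q \<le> s"
    if "p \<in> \<rat>" "q \<in> \<rat>" "s \<in> \<rat>" "0 \<le> p" "p \<le> q" "q \<le> 1" for p q s
  proof -
    obtain p' q' s' where r: "p = of_rat p'" "q = of_rat q'" "s = of_rat s'"
      using \<open>p \<in> \<rat>\<close> \<open>q \<in> \<rat>\<close> \<open>s \<in> \<rat>\<close> by (auto simp: Rats_def)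
    then have "(p', q', s') \<in> rational_graph S \<longleftrightarrow> (p', q', s') \<in> rational_graph S'"
      using eq by simp
    then show ?thesis using that(4-6) by (simp add: rational_graph_def S r of_rat_less_eq)
  qed
  show "S = S'"
    unfolding S
  proof (rule cyclic_structure_eqI[OF A B])
    fix u v :: real assume "u \<in> {0..1}" "v \<in> {0..1}" "u \<le> v"
    then show "cyclic_structure.rho 0 1 Fm u v = cyclic_structure.rho 0 1 Fm' u v"
      using rho_le_of_rational[OF A' B', of u v] rho_le_of_rational[OF B' A', of u v] iff
      by (intro antisym) auto
  qed
qed

lemma cyclic_structures_lepoll_real: "cyclic_structures {0..1::real} 0 1 \<lesssim> (UNIV :: real set)"
proof -
  have "cyclic_structures {0..1::real} 0 1 \<lesssim> (UNIV :: (rat \<times> rat \<times> rat) set set)"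
    using inj_on_rational_graph by (auto simp: lepoll_def)
  also have "\<dots> \<lesssim> (UNIV :: nat set set)"
    unfolding lepoll_def
    by (intro exI[of _ "image to_nat"]) (simp add: inj_on_image)
  also have "\<dots> \<approx> (UNIV :: real set)"
    by (rule nat_sets_eqpoll_reals)
  finally show ?thesis .
qed

subsection \<open>The action of the order automorphisms\<close>

lemma dual_map_le: "dual_map n f j \<le> n + 1"
proof (cases "\<exists>i\<le>n. j \<le> f i")
  case True
  then obtain i where i: "i \<le> n \<and> j \<le> f i" by blast
  have "(LEAST i. i \<le> n \<and> j \<le> f i) \<le> i" using i by (rule Least_le)
  then show ?thesis using i by (simp add: dual_map_def)
next
  case False
  then have "dual_map n f j = n + 1" unfolding dual_map_def by (rule if_not_P)
  then show ?thesis by simp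
qed

lemma order_aut_mult:
  assumes "\<gamma> \<in> carrier (order_aut I)" "\<delta> \<in> carrier (order_aut I)"
  shows "\<gamma> \<otimes>\<^bsub>order_aut I\<^esub> \<delta> = compose I \<gamma> \<delta>"
  using assms by (simp add: order_aut_def BijGroup_def)

lemma order_aut_one: "\<one>\<^bsub>order_aut I\<^esub> = (\<lambda>x\<in>I. x)"
  by (simp add: order_aut_def BijGroup_def)

lemma order_autD:
  assumes "\<gamma> \<in> carrier (order_aut I)"
  shows "\<gamma> \<in> Bij I" "bij_betw \<gamma> I I" "x \<in> I \<Longrightarrow> \<gamma> x \<in> I"
    "x \<in> I \<Longrightarrow> y \<in> I \<Longrightarrow> \<gamma> x \<le> \<gamma> y \<longleftrightarrow> x \<le> y"
  using assms by (auto simp: order_aut_def Bij_def bij_betw_def)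

lemma group_order_aut: "group (order_aut I)"
proof -
  interpret B: group "BijGroup I" by (rule group_BijGroup)
  have "subgroup {\<gamma> \<in> Bij I. \<forall>x\<in>I. \<forall>y\<in>I. \<gamma> x \<le> \<gamma> y \<longleftrightarrow> x \<le> y} (BijGroup I)" (is "subgroup ?H _")
  proof (rule B.subgroupI)
    show "?H \<subseteq> carrier (BijGroup I)" by (auto simp: BijGroup_def)
    have "(\<lambda>x\<in>I. x) \<in> ?H" using id_Bij[of I] by simp
    then show "?H \<noteq> {}" by blast
  next
    fix \<gamma> assume \<gamma>: "\<gamma> \<in> ?H"
    then have B: "\<gamma> \<in> Bij I" and bij: "bij_betw \<gamma> I I"
      and mono: "x \<in> I \<Longrightarrow> y \<in> I \<Longrightarrow> \<gamma> x \<le> \<gamma> y \<longleftrightarrow> x \<le> y" for x y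
      by (simp_all add: Bij_def)
    have "inv_into I \<gamma> x \<le> inv_into I \<gamma> y \<longleftrightarrow> x \<le> y" if "x \<in> I" "y \<in> I" for x y
    proof -
      have "\<gamma> (inv_into I \<gamma> x) \<le> \<gamma> (inv_into I \<gamma> y) \<longleftrightarrow> inv_into I \<gamma> x \<le> inv_into I \<gamma> y"
        by (rule mono[OF Bij_inv_into_mem[OF B that(1)] Bij_inv_into_mem[OF B that(2)]])
      then show ?thesis using that bij by (simp add: bij_betw_inv_into_right)
    qed
    then show "inv\<^bsub>BijGroup I\<^esub> \<gamma> \<in> ?H"
      using restrict_inv_into_Bij[OF B] by (simp add: inv_BijGroup[OF B])
  next
    fix \<gamma> \<delta> assume *: "\<gamma> \<in> ?H" "\<delta> \<in> ?H"
    then have "\<delta> x \<in> I" if "x \<in> I" for x using that Bij_imp_funcset by blast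
    with * show "\<gamma> \<otimes>\<^bsub>BijGroup I\<^esub> \<delta> \<in> ?H"
      by (simp add: BijGroup_def compose_Bij compose_eq)
  qed
  from subgroup.subgroup_is_group[OF this B.is_group]
  show ?thesis by (simp add: order_aut_def)
qed

section \<open>Conjugation of cyclic structures by automorphisms\<close>

context
  fixes I :: "'a::linorder set" and b t
  assumes interval: "order_interval I b t"
begin

text \<open>By surjectivity an endpoint has a preimage; comparing that preimage with the endpoint
  itself leaves no other value.\<close>

lemma order_aut_endpoints:
  assumes "\<gamma> \<in> carrier (order_aut I)"
  shows "\<gamma> b = b" "\<gamma> t = t"
proof -
  have I: "b \<in> I" "t \<in> I" "\<And>x. x \<in> I \<Longrightarrow> b \<le> x \<and> x \<le> t"
    using interval by (auto simp: order_interval_def)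
  have surj: "\<exists>x\<in>I. \<gamma> x = y" if "y \<in> I" for y
    using order_autD(2)[OF assms] that by (metis bij_betw_def imageE)
  obtain x where "x \<in> I" "\<gamma> x = b" using surj I by blast
  then show "\<gamma> b = b"
    using order_autD(3,4)[OF assms] I by (metis order.antisym)
  obtain y where "y \<in> I" "\<gamma> y = t" using surj I by blast
  then show "\<gamma> t = t"
    using order_autD(3,4)[OF assms] I by (metis order.antisym)
qed

lemma aut_on_obj_in:
  assumes "\<gamma> \<in> carrier (order_aut I)"
  shows "aut_on_obj I b t \<gamma> n \<in> interval_obj I b t n \<rightarrow>\<^sub>E interval_obj I b t n"
proof
  fix \<beta> assume \<beta>: "\<beta> \<in> interval_obj I b t n"
  note \<beta>D = interval_objD[OF \<beta>]
  show "aut_on_obj I b t \<gamma> n \<beta> \<in> interval_obj I b t n"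
    using \<beta> \<beta>D order_autD(3,4)[OF assms] order_aut_endpoints[OF assms]
    by (auto simp: aut_on_obj_def interval_obj_def mono_on_def PiE_iff)
qed (simp add: aut_on_obj_def)

lemma aut_on_obj_apply:
  assumes "\<gamma> \<in> carrier (order_aut I)" "\<beta> \<in> interval_obj I b t n"
  shows "aut_on_obj I b t \<gamma> n \<beta> \<in> interval_obj I b t n"
  using PiE_mem[OF aut_on_obj_in[OF assms(1)] assms(2)] .

lemma aut_on_obj_mult:
  assumes "\<gamma> \<in> carrier (order_aut I)" "\<delta> \<in> carrier (order_aut I)" "\<beta> \<in> interval_obj I b t n"
  shows "aut_on_obj I b t (\<gamma> \<otimes>\<^bsub>order_aut I\<^esub> \<delta>) n \<beta>
    = aut_on_obj I b t \<gamma> n (aut_on_obj I b t \<delta> n \<beta>)"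
  using aut_on_obj_apply[OF assms(2,3)] assms(3) interval_objD(3)[OF assms(3)]
  by (auto simp: aut_on_obj_def order_aut_mult[OF assms(1,2)] compose_eq fun_eq_iff)

lemma aut_on_obj_one:
  assumes "\<beta> \<in> interval_obj I b t n"
  shows "aut_on_obj I b t \<one>\<^bsub>order_aut I\<^esub> n \<beta> = \<beta>"
proof (rule extensionalityI)
  show "\<beta> \<in> extensional {..n+1}" using interval_objD(5)[OF assms] .
qed (use assms interval_objD(3)[OF assms] in \<open>auto simp: aut_on_obj_def order_aut_one\<close>)

lemma aut_on_obj_inv:
  assumes "\<gamma> \<in> carrier (order_aut I)" "\<beta> \<in> interval_obj I b t n"
  shows "aut_on_obj I b t \<gamma> n (aut_on_obj I b t (inv\<^bsub>order_aut I\<^esub> \<gamma>) n \<beta>) = \<beta>"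
    and "aut_on_obj I b t (inv\<^bsub>order_aut I\<^esub> \<gamma>) n (aut_on_obj I b t \<gamma> n \<beta>) = \<beta>"
proof -
  interpret G: group "order_aut I" by (rule group_order_aut)
  show "aut_on_obj I b t \<gamma> n (aut_on_obj I b t (inv\<^bsub>order_aut I\<^esub> \<gamma>) n \<beta>) = \<beta>"
    using aut_on_obj_mult[OF assms(1) G.inv_closed[OF assms(1)] assms(2)]
      aut_on_obj_one[OF assms(2)] G.r_inv[OF assms(1)] by simp
  show "aut_on_obj I b t (inv\<^bsub>order_aut I\<^esub> \<gamma>) n (aut_on_obj I b t \<gamma> n \<beta>) = \<beta>"
    using aut_on_obj_mult[OF G.inv_closed[OF assms(1)] assms]
      aut_on_obj_one[OF assms(2)] G.l_inv[OF assms(1)] by simp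
qed

text \<open>Termwise application commutes with reindexing.\<close>

lemma aut_on_obj_natural:
  assumes "\<gamma> \<in> carrier (order_aut I)" "\<beta> \<in> interval_obj I b t n"
    "interval_mor I b t n m f \<beta> \<in> interval_obj I b t m"
  shows "aut_on_obj I b t \<gamma> m (interval_mor I b t n m f \<beta>)
    = interval_mor I b t n m f (aut_on_obj I b t \<gamma> n \<beta>)"
  using assms(3) aut_on_obj_apply[OF assms(1,2)] dual_map_le[of n f]
  by (auto simp: aut_on_obj_def interval_mor_def assms(2) fun_eq_iff)

text \<open>The morphism part of \<open>aut_action\<close>, with the object part already replaced by
  its forced value.\<close>

definition conj_mor where
  "conj_mor \<gamma> Fm n m = (\<lambda>f\<in>lambda_hom n m.
     compose (interval_obj I b t n) (aut_on_obj I b t \<gamma> m)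
       (compose (interval_obj I b t n) (Fm n m f) (aut_on_obj I b t (inv\<^bsub>order_aut I\<^esub> \<gamma>) n)))"

lemma aut_action_eq:
  assumes "(Fo, Fm) \<in> cyclic_structures I b t"
  shows "aut_action I b t \<gamma> (Fo, Fm) = (Fo, conj_mor \<gamma> Fm)"
proof -
  have "Fo n = interval_obj I b t n" for n using assms by (simp add: cyclic_structures_def)
  then show ?thesis using assms by (auto simp: aut_action_def conj_mor_def fun_eq_iff)
qed

context
  fixes \<gamma> Fo Fm
  assumes \<gamma>: "\<gamma> \<in> carrier (order_aut I)" and S: "(Fo, Fm) \<in> cyclic_structures I b t"
begin

interpretation cyclic_structure I b t Fo Fm
  using interval S by (simp add: cyclic_structure_def)

lemma inv_carrier: "inv\<^bsub>order_aut I\<^esub> \<gamma> \<in> carrier (order_aut I)"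
  by (rule group.inv_closed[OF group_order_aut \<gamma>])

lemma Fm_apply:
  "f \<in> lambda_hom n m \<Longrightarrow> \<beta> \<in> interval_obj I b t n \<Longrightarrow> Fm n m f \<beta> \<in> interval_obj I b t m"
  using PiE_mem[OF PiE_mem[OF Fm_in], of f n m \<beta>] by (simp add: obj)

lemma conj_mor_apply:
  "f \<in> lambda_hom n m \<Longrightarrow> \<beta> \<in> interval_obj I b t n \<Longrightarrow>
    conj_mor \<gamma> Fm n m f \<beta> = aut_on_obj I b t \<gamma> m (Fm n m f (aut_on_obj I b t (inv\<^bsub>order_aut I\<^esub> \<gamma>) n \<beta>))"
  by (simp add: conj_mor_def compose_eq)

lemma conj_mor_in_obj:
  "f \<in> lambda_hom n m \<Longrightarrow> \<beta> \<in> interval_obj I b t n \<Longrightarrow> conj_mor \<gamma> Fm n m f \<beta> \<in> interval_obj I b t m"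
  by (simp add: conj_mor_apply aut_on_obj_apply \<gamma> inv_carrier Fm_apply)

lemma conj_mor_extensional:
  "f \<in> lambda_hom n m \<Longrightarrow> conj_mor \<gamma> Fm n m f \<in> extensional (interval_obj I b t n)"
  by (simp add: conj_mor_def)

text \<open>In a composite, the automorphism and its inverse cancel in the middle, so conjugation
  preserves functoriality. On simplicial maps naturality brings them together and the prescribed map
  is unchanged.\<close>

lemma conj_mor_cyclic: "(Fo, conj_mor \<gamma> Fm) \<in> cyclic_structures I b t"
proof -
  have id: "lambda_id n \<in> lambda_hom n n" for n
    unfolding lambda_id_def by (rule lambda_class_in_hom[OF lambda_map_id])
  have "conj_mor \<gamma> Fm n m \<in> lambda_hom n m \<rightarrow>\<^sub>E (interval_obj I b t n \<rightarrow>\<^sub>E interval_obj I b t m)" for n m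
  proof (rule PiE_I)
    show "conj_mor \<gamma> Fm n m f \<in> interval_obj I b t n \<rightarrow>\<^sub>E interval_obj I b t m"
      if "f \<in> lambda_hom n m" for f
      using conj_mor_in_obj[OF that] conj_mor_extensional[OF that] by (simp add: PiE_iff)
  qed (simp add: conj_mor_def)
  moreover have "conj_mor \<gamma> Fm n n (lambda_id n) = (\<lambda>x\<in>interval_obj I b t n. x)" for n
  proof (rule extensionalityI)
    fix \<beta> assume \<beta>: "\<beta> \<in> interval_obj I b t n"
    have "Fm n n (lambda_id n) = (\<lambda>x\<in>interval_obj I b t n. x)"
      using is_functor by (simp add: lambda_functor_def obj)
    then show "conj_mor \<gamma> Fm n n (lambda_id n) \<beta> = (\<lambda>x\<in>interval_obj I b t n. x) \<beta>"
      using \<beta> aut_on_obj_apply[OF inv_carrier \<beta>] aut_on_obj_inv(1)[OF \<gamma> \<beta>]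
      by (simp add: conj_mor_apply[OF id \<beta>])
  qed (use conj_mor_extensional[OF id] in auto)
  moreover have "conj_mor \<gamma> Fm n p (lambda_comp g f)
      = compose (interval_obj I b t n) (conj_mor \<gamma> Fm m p g) (conj_mor \<gamma> Fm n m f)"
    if f: "f \<in> lambda_hom n m" and g: "g \<in> lambda_hom m p" for n m p f g
  proof (rule extensionalityI)
    fix \<beta> assume \<beta>: "\<beta> \<in> interval_obj I b t n"
    have "Fm n p (lambda_comp g f) = compose (interval_obj I b t n) (Fm m p g) (Fm n m f)"
      using is_functor f g by (simp add: lambda_functor_def obj)
    then show "conj_mor \<gamma> Fm n p (lambda_comp g f) \<beta>
        = compose (interval_obj I b t n) (conj_mor \<gamma> Fm m p g) (conj_mor \<gamma> Fm n m f) \<beta>"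
      using \<beta> aut_on_obj_apply[OF inv_carrier \<beta>]
        aut_on_obj_inv(2)[OF \<gamma> Fm_apply[OF f aut_on_obj_apply[OF inv_carrier \<beta>]]]
        conj_mor_apply[OF f \<beta>] conj_mor_apply[OF lambda_comp_in_hom[OF f g] \<beta>]
        conj_mor_apply[OF g conj_mor_in_obj[OF f \<beta>]]
      by (simp add: compose_eq)
  qed (use conj_mor_extensional[OF lambda_comp_in_hom[OF f g]] in auto)
  moreover have "conj_mor \<gamma> Fm n m (delta_to_lambda n m f) = interval_mor I b t n m f"
    if f: "f \<in> delta_hom n m" and "delta_to_lambda n m f \<in> lambda_hom n m" for n m f
  proof (rule extensionalityI)
    note hom = that(2)
    fix \<beta> assume \<beta>: "\<beta> \<in> interval_obj I b t n"
    let ?\<delta> = "aut_on_obj I b t (inv\<^bsub>order_aut I\<^esub> \<gamma>) n \<beta>"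
    have \<delta>: "?\<delta> \<in> interval_obj I b t n" by (rule aut_on_obj_apply[OF inv_carrier \<beta>])
    have "interval_mor I b t n m f ?\<delta> \<in> interval_obj I b t m"
      using Fm_apply[OF hom \<delta>] extends[OF f] by simp
    from aut_on_obj_natural[OF \<gamma> \<delta> this]
    show "conj_mor \<gamma> Fm n m (delta_to_lambda n m f) \<beta> = interval_mor I b t n m f \<beta>"
      using conj_mor_apply[OF hom \<beta>] extends[OF f] aut_on_obj_inv(1)[OF \<gamma> \<beta>] by simp
  qed (use conj_mor_extensional[OF that(2)] in \<open>auto simp: interval_mor_def\<close>)
  ultimately show ?thesis
    using delta_to_lambda_in_hom by (simp add: cyclic_structures_def lambda_functor_def obj)
qed

end

end

lemma aut_action_group_action:
  assumes interval: "order_interval I b t"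
  shows "group_action (order_aut I) (cyclic_structures I b t) (aut_action I b t)"
proof -
  interpret G: group "order_aut I" by (rule group_order_aut)
  let ?E = "cyclic_structures I b t" and ?\<phi> = "aut_action I b t"
  have closed: "?\<phi> \<gamma> S \<in> ?E" if "\<gamma> \<in> carrier (order_aut I)" "S \<in> ?E" for \<gamma> S
    using that aut_action_eq[OF interval] conj_mor_cyclic[OF interval] by (cases S) simp
  \<comment> \<open>Extensionality of all the maps reduces equality of structures to a check on
    elements.\<close>
  have conj_eqI: "conj_mor I b t \<gamma> Fm = Fm'"
    if S: "(Fo, Fm) \<in> ?E" and S': "(Fo, Fm') \<in> ?E" and \<gamma>: "\<gamma> \<in> carrier (order_aut I)"
      and eq: "\<And>n m f \<beta>. f \<in> lambda_hom n m \<Longrightarrow> \<beta> \<in> interval_obj I b t n \<Longrightarrow>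
        aut_on_obj I b t \<gamma> m (Fm n m f (aut_on_obj I b t (inv\<^bsub>order_aut I\<^esub> \<gamma>) n \<beta>)) = Fm' n m f \<beta>"
    for \<gamma> Fo Fm Fm'
  proof (intro ext[of "conj_mor I b t \<gamma> Fm"] ext[of "conj_mor I b t \<gamma> Fm _"])
    fix n m
    interpret cyclic_structure I b t Fo Fm' using interval S' by (simp add: cyclic_structure_def)
    show "conj_mor I b t \<gamma> Fm n m = Fm' n m"
    proof (rule extensionalityI)
      show "conj_mor I b t \<gamma> Fm n m \<in> extensional (lambda_hom n m)"
        by (simp add: conj_mor_def[OF interval])
      show "Fm' n m \<in> extensional (lambda_hom n m)" using Fm_in by (simp add: PiE_def)
      fix f assume f: "f \<in> lambda_hom n m"
      show "conj_mor I b t \<gamma> Fm n m f = Fm' n m f"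
      proof (rule extensionalityI)
        show "conj_mor I b t \<gamma> Fm n m f \<in> extensional (interval_obj I b t n)"
          by (rule conj_mor_extensional[OF interval \<gamma> S f])
        show "Fm' n m f \<in> extensional (interval_obj I b t n)"
          using PiE_mem[OF Fm_in f] by (simp add: PiE_def obj)
      qed (simp add: conj_mor_apply[OF interval \<gamma> S f] eq[OF f])
    qed
  qed
  have one: "?\<phi> \<one>\<^bsub>order_aut I\<^esub> S = S" if SE: "S \<in> ?E" for S
  proof -
    obtain Fo Fm where S: "S = (Fo, Fm)" by (cases S)
    have "conj_mor I b t \<one>\<^bsub>order_aut I\<^esub> Fm = Fm"
      by (rule conj_eqI[OF SE[unfolded S] SE[unfolded S] G.one_closed])
        (simp add: aut_on_obj_one[OF interval] Fm_apply[OF interval G.one_closed SE[unfolded S]])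
    then show ?thesis using aut_action_eq[OF interval SE[unfolded S]] S by simp
  qed
  have mult: "?\<phi> (\<gamma> \<otimes>\<^bsub>order_aut I\<^esub> \<delta>) S = ?\<phi> \<gamma> (?\<phi> \<delta> S)"
    if \<gamma>: "\<gamma> \<in> carrier (order_aut I)" and \<delta>: "\<delta> \<in> carrier (order_aut I)" and SE: "S \<in> ?E" for \<gamma> \<delta> S
  proof -
    obtain Fo Fm where S: "S = (Fo, Fm)" by (cases S)
    note S1 = SE[unfolded S]
    note S2 = conj_mor_cyclic[OF interval \<delta> S1]
    note S3 = conj_mor_cyclic[OF interval \<gamma> S2]
    note gd = G.m_closed[OF \<gamma> \<delta>] and inv = G.inv_closed[OF \<gamma>] G.inv_closed[OF \<delta>]
    have "conj_mor I b t (\<gamma> \<otimes>\<^bsub>order_aut I\<^esub> \<delta>) Fm = conj_mor I b t \<gamma> (conj_mor I b t \<delta> Fm)"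
    proof (rule conj_eqI[OF S1 S3 gd])
      fix n m f \<beta> assume f: "f \<in> lambda_hom n m" and \<beta>: "\<beta> \<in> interval_obj I b t n"
      note \<beta>1 = aut_on_obj_apply[OF interval inv(1) \<beta>]
      note \<beta>2 = aut_on_obj_apply[OF interval inv(2) \<beta>1]
      show "aut_on_obj I b t (\<gamma> \<otimes>\<^bsub>order_aut I\<^esub> \<delta>) m
          (Fm n m f (aut_on_obj I b t (inv\<^bsub>order_aut I\<^esub> (\<gamma> \<otimes>\<^bsub>order_aut I\<^esub> \<delta>)) n \<beta>))
        = conj_mor I b t \<gamma> (conj_mor I b t \<delta> Fm) n m f \<beta>"
        by (simp add: conj_mor_apply[OF interval \<gamma> S2 f \<beta>] conj_mor_apply[OF interval \<delta> S1 f \<beta>1]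
            G.inv_mult_group[OF \<gamma> \<delta>] aut_on_obj_mult[OF interval inv(2,1) \<beta>]
            aut_on_obj_mult[OF interval \<gamma> \<delta> Fm_apply[OF interval \<delta> S1 f \<beta>2]])
    qed
    then show ?thesis
      using aut_action_eq[OF interval S1] aut_action_eq[OF interval S2] S by simp
  qed
  have Bij: "?\<phi> \<gamma> \<in> Bij ?E" if \<gamma>: "\<gamma> \<in> carrier (order_aut I)" for \<gamma>
  proof -
    have "bij_betw (?\<phi> \<gamma>) ?E ?E"
    proof (rule bij_betw_byWitness[where f' = "?\<phi> (inv\<^bsub>order_aut I\<^esub> \<gamma>)"])
      show "\<forall>S\<in>?E. ?\<phi> (inv\<^bsub>order_aut I\<^esub> \<gamma>) (?\<phi> \<gamma> S) = S"
        using mult[OF G.inv_closed[OF \<gamma>] \<gamma>] one G.l_inv[OF \<gamma>] by simp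
      show "\<forall>S\<in>?E. ?\<phi> \<gamma> (?\<phi> (inv\<^bsub>order_aut I\<^esub> \<gamma>) S) = S"
        using mult[OF \<gamma> G.inv_closed[OF \<gamma>]] one G.r_inv[OF \<gamma>] by simp
    qed (use closed \<gamma> G.inv_closed in blast)+
    then show ?thesis by (simp add: Bij_def aut_action_def)
  qed
  have "?\<phi> (\<gamma> \<otimes>\<^bsub>order_aut I\<^esub> \<delta>) = ?\<phi> \<gamma> \<otimes>\<^bsub>BijGroup ?E\<^esub> ?\<phi> \<delta>"
    if \<gamma>: "\<gamma> \<in> carrier (order_aut I)" and \<delta>: "\<delta> \<in> carrier (order_aut I)" for \<gamma> \<delta>
  proof -
    have "?\<phi> (\<gamma> \<otimes>\<^bsub>order_aut I\<^esub> \<delta>) = compose ?E (?\<phi> \<gamma>) (?\<phi> \<delta>)"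
    proof (rule extensionalityI)
      show "?\<phi> (\<gamma> \<otimes>\<^bsub>order_aut I\<^esub> \<delta>) \<in> extensional ?E"
        using Bij[OF G.m_closed[OF \<gamma> \<delta>]] by (simp add: Bij_def)
    qed (simp_all add: mult[OF \<gamma> \<delta>] compose_eq)
    then show ?thesis using Bij \<gamma> \<delta> by (simp add: BijGroup_def)
  qed
  then have "?\<phi> \<in> hom (order_aut I) (BijGroup ?E)"
    using Bij by (simp add: hom_def BijGroup_def)
  then show ?thesis
    unfolding group_action_def group_hom_def group_hom_axioms_def
    using group_order_aut group_BijGroup by blast
qed

subsection \<open>A continuum of structures on the unit interval\<close>

abbreviation unit_obj :: "nat \<Rightarrow> (nat \<Rightarrow> real) set" where
  "unit_obj \<equiv> interval_obj {0..1} 0 1"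

text \<open>
  The standard structure: \<open>\<beta>\<close> becomes a monotone map from \<open>\<int>\<close> to \<open>\<real>\<close> commuting with the shifts by
  \<open>n+1\<close> and by \<open>1\<close>, and \<open>f\<close> acts by precomposition with its adjoint, renormalised to vanish at \<open>0\<close>.
\<close>

definition periodic_ext :: "nat \<Rightarrow> (nat \<Rightarrow> real) \<Rightarrow> int \<Rightarrow> real" where
  "periodic_ext n \<beta> x = \<beta> (nat (x mod (int n + 1))) + of_int (x div (int n + 1))"

lemma periodic_ext_shift: "periodic_ext n \<beta> (x + k * (int n + 1)) = periodic_ext n \<beta> x + of_int k"
proof -
  have "(x + k * (int n + 1)) div (int n + 1) = x div (int n + 1) + k"
    using div_mult_self1[of "int n + 1" x k] by simp
  then show ?thesis by (simp add: periodic_ext_def)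
qed

context
  fixes n \<beta> assumes \<beta>: "\<beta> \<in> unit_obj n"
begin

lemma periodic_ext_of_nat: "j \<le> n + 1 \<Longrightarrow> periodic_ext n \<beta> (int j) = \<beta> j"
proof (cases "j = n + 1")
  case True
  \<comment> \<open>The index \<open>n + 1\<close> is read as 0 in the next period; the added 1
    agrees with the endpoint value of \<beta>.\<close>
  have "periodic_ext n \<beta> 0 = 0"
    using interval_objD(1)[OF \<beta>] by (simp add: periodic_ext_def)
  then show ?thesis
    using True periodic_ext_shift[of n \<beta> 0 1] interval_objD(2)[OF \<beta>] by (simp add: add.commute)
qed (auto simp: periodic_ext_def)

lemma periodic_ext_mono:
  assumes "x \<le> y" shows "periodic_ext n \<beta> x \<le> periodic_ext n \<beta> y"
proof -
  let ?r = "\<lambda>x. nat (x mod (int n + 1))" and ?q = "\<lambda>x. x div (int n + 1)"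
  have r: "?r x \<le> n + 1" for x
    using pos_mod_bound[of "int n + 1" x] by simp
  show ?thesis
  proof (cases "?q x = ?q y")
    case True
    then have "x mod (int n + 1) \<le> y mod (int n + 1)"
      using assms by (simp add: minus_div_mult_eq_mod[symmetric])
    then show ?thesis
      using True interval_objD(4)[OF \<beta> nat_mono r] by (simp add: periodic_ext_def)
  next
    \<comment> \<open>Across periods the quotient gains at least 1, while \<beta> varies by at most
      1.\<close>
    case False
    then have "?q x + 1 \<le> ?q y" using zdiv_mono1[OF assms, of "int n + 1"] by simp
    then have "real_of_int (?q x) + 1 \<le> of_int (?q y)" by linarith
    moreover have "\<beta> (?r x) \<le> 1" "0 \<le> \<beta> (?r y)"
      using interval_objD(3)[OF \<beta> r] by auto
    ultimately show ?thesis by (simp add: periodic_ext_def)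
  qed
qed

end

definition standard_act :: "nat \<Rightarrow> nat \<Rightarrow> (int \<Rightarrow> int) \<Rightarrow> (nat \<Rightarrow> real) \<Rightarrow> nat \<Rightarrow> real" where
  "standard_act n m f \<beta> = (\<lambda>j\<in>{..m+1}.
     periodic_ext n \<beta> (lower_adj f (int j)) - periodic_ext n \<beta> (lower_adj f 0))"

lemma standard_act_in:
  assumes f: "f \<in> lambda_map n m" and \<beta>: "\<beta> \<in> unit_obj n"
  shows "standard_act n m f \<beta> \<in> unit_obj m"
proof -
  let ?p = "periodic_ext n \<beta>" and ?a = "lower_adj f"
  have le: "?p (?a i) \<le> ?p (?a j)" if "i \<le> j" for i j
    by (rule periodic_ext_mono[OF \<beta> lower_adj_mono[OF f that]])
  have end1: "?p (?a (int m + 1)) = ?p (?a 0) + 1"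
    using lower_adj_shift[OF f, of 0 1] periodic_ext_shift[of n \<beta> "?a 0" 1] by simp
  have "0 \<le> ?p (?a (int j)) - ?p (?a 0) \<and> ?p (?a (int j)) - ?p (?a 0) \<le> 1" if "j \<le> m + 1" for j
    using le[of 0 "int j"] le[of "int j" "int m + 1"] that end1 by simp
  then show ?thesis
    using le end1 by (auto simp: interval_obj_def standard_act_def mono_on_def add.commute)
qed

text \<open>Extending after the action is pulling back the extension up to a constant. In a
  composite these constants cancel, which gives functoriality.\<close>

lemma periodic_ext_standard_act:
  assumes f: "f \<in> lambda_map n m" and \<beta>: "\<beta> \<in> unit_obj n"
  shows "periodic_ext m (standard_act n m f \<beta>) x
    = periodic_ext n \<beta> (lower_adj f x) - periodic_ext n \<beta> (lower_adj f 0)"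
proof -
  define r k where "r = x mod (int m + 1)" and "k = x div (int m + 1)"
  have x: "x = r + k * (int m + 1)" by (simp only: r_def k_def mod_div_mult_eq)
  have r: "0 \<le> r" "r \<le> int m"
    using pos_mod_sign[of "int m + 1" x] pos_mod_bound[of "int m + 1" x] by (auto simp: r_def)
  have "periodic_ext m (standard_act n m f \<beta>) r = standard_act n m f \<beta> (nat r)"
    using periodic_ext_of_nat[OF standard_act_in[OF assms], of "nat r"] r by simp
  also have "\<dots> = periodic_ext n \<beta> (lower_adj f r) - periodic_ext n \<beta> (lower_adj f 0)"
    using r nat_le_iff[of r "m + 1"] by (simp add: standard_act_def)
  finally show ?thesis
    unfolding x periodic_ext_shift lower_adj_shift[OF f] by simp
qed

lemma standard_act_comp:
  assumes f: "f \<in> lambda_map n m" and g: "g \<in> lambda_map m p" and \<beta>: "\<beta> \<in> unit_obj n"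
  shows "standard_act m p g (standard_act n m f \<beta>) = standard_act n p (g \<circ> f) \<beta>"
  unfolding standard_act_def[of m p g] standard_act_def[of n p "g \<circ> f"]
    periodic_ext_standard_act[OF f \<beta>] lower_adj_comp[OF f g] by simp

lemma standard_act_id:
  assumes "\<beta> \<in> unit_obj n" shows "standard_act n n id \<beta> = \<beta>"
proof (rule extensionalityI)
  show "\<beta> \<in> extensional {..n+1}" using interval_objD(5)[OF assms] .
qed (use periodic_ext_of_nat[OF assms] periodic_ext_of_nat[OF assms, of 0] interval_objD(1)[OF assms]
    in \<open>auto simp: standard_act_def lower_adj_id\<close>)

definition standard_mor :: "nat \<Rightarrow> nat \<Rightarrow> (int \<Rightarrow> int) set \<Rightarrow> (nat \<Rightarrow> real) \<Rightarrow> (nat \<Rightarrow> real)" where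
  "standard_mor n m = (\<lambda>F\<in>lambda_hom n m. \<lambda>\<beta>\<in>unit_obj n. standard_act n m (SOME f. f \<in> F) \<beta>)"

text \<open>Another representative shifts the adjoint by whole periods. This adds a constant to the
  extension, which the renormalisation at 0 removes.\<close>

lemma standard_mor_class:
  assumes f: "f \<in> lambda_map n m" and \<beta>: "\<beta> \<in> unit_obj n"
  shows "standard_mor n m (lambda_class n m f) \<beta> = standard_act n m f \<beta>"
proof -
  have "f \<in> lambda_class n m f"
    unfolding lambda_class_eq[OF f] by (auto intro!: exI[of _ 0])
  then have "(SOME g. g \<in> lambda_class n m f) \<in> lambda_class n m f"
    by (rule someI[of "\<lambda>g. g \<in> lambda_class n m f"])
  then obtain k where k: "(SOME g. g \<in> lambda_class n m f) = (\<lambda>x. f x + k * (int m + 1))"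
    unfolding lambda_class_eq[OF f] by blast
  let ?g = "\<lambda>x. f x + k * (int m + 1)"
  have g: "?g \<in> lambda_map n m" using f by (auto simp: lambda_map_def mono_def)
  have "lower_adj ?g j = lower_adj f j - k * (int n + 1)" for j
  proof (rule lower_adj_eqI[OF g])
    have *: "f (x - k * (int n + 1)) + k * (int m + 1) = f x" for x
      using lambda_map_shift[OF f, of "x - k * (int n + 1)" k] by simp
    show "j \<le> f (lower_adj f j - k * (int n + 1)) + k * (int m + 1)"
      unfolding * using lower_adj_iff[OF f, of j "lower_adj f j"] by simp
    have "f (lower_adj f j - 1) < j"
      using lower_adj_iff[OF f, of j "lower_adj f j - 1"] by simp
    then show "f (lower_adj f j - k * (int n + 1) - 1) + k * (int m + 1) < j"
      using *[of "lower_adj f j - 1"] by (simp add: algebra_simps)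
  qed
  then have "periodic_ext n \<beta> (lower_adj ?g j) = periodic_ext n \<beta> (lower_adj f j) - of_int k" for j
    using periodic_ext_shift[of n \<beta> "lower_adj f j" "- k"] by simp
  then have "standard_act n m ?g \<beta> = standard_act n m f \<beta>"
    by (simp add: standard_act_def)
  then show ?thesis
    using \<beta> lambda_class_in_hom[OF f] by (simp add: standard_mor_def k)
qed

lemma standard_mor_in:
  assumes "F \<in> lambda_hom n m" shows "standard_mor n m F \<in> unit_obj n \<rightarrow>\<^sub>E unit_obj m"
proof (rule PiE_I)
  fix \<beta> assume \<beta>: "\<beta> \<in> unit_obj n"
  obtain f where f: "f \<in> lambda_map n m" "F = lambda_class n m f"
    using assms by (rule lambda_homE)
  show "standard_mor n m F \<beta> \<in> unit_obj m"
    unfolding f(2) standard_mor_class[OF f(1) \<beta>] by (rule standard_act_in[OF f(1) \<beta>])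
qed (use assms in \<open>simp add: standard_mor_def\<close>)

lemma standard_mor_extensional: "F \<in> lambda_hom n m \<Longrightarrow> standard_mor n m F \<in> extensional (unit_obj n)"
  by (simp add: standard_mor_def)

lemma standard_cyclic_structure: "(unit_obj, standard_mor) \<in> cyclic_structures {0..1} 0 1"
proof -
  have "standard_mor n m \<in> lambda_hom n m \<rightarrow>\<^sub>E (unit_obj n \<rightarrow>\<^sub>E unit_obj m)" for n m
    by (rule PiE_I) (auto simp: standard_mor_in, simp add: standard_mor_def)
  moreover have "standard_mor n n (lambda_id n) = (\<lambda>x\<in>unit_obj n. x)" for n
  proof (rule extensionalityI)
    show "standard_mor n n (lambda_id n) \<in> extensional (unit_obj n)"
      unfolding lambda_id_def
      by (rule standard_mor_extensional[OF lambda_class_in_hom[OF lambda_map_id]])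
  qed (simp_all add: lambda_id_def standard_mor_class[OF lambda_map_id] standard_act_id)
  moreover have "standard_mor n p (lambda_comp G F) = compose (unit_obj n) (standard_mor m p G) (standard_mor n m F)"
    if F: "F \<in> lambda_hom n m" and G: "G \<in> lambda_hom m p" for n m p F G
  proof (rule extensionalityI)
    obtain f where f: "f \<in> lambda_map n m" "F = lambda_class n m f" using F by (rule lambda_homE)
    obtain g where g: "g \<in> lambda_map m p" "G = lambda_class m p g" using G by (rule lambda_homE)
    fix \<beta> assume \<beta>: "\<beta> \<in> unit_obj n"
    show "standard_mor n p (lambda_comp G F) \<beta> = compose (unit_obj n) (standard_mor m p G) (standard_mor n m F) \<beta>"
      using \<beta> standard_act_in[OF f(1) \<beta>]
      by (simp add: f(2) g(2) lambda_comp_class[OF f(1) g(1)] compose_eq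
          standard_mor_class[OF lambda_map_comp[OF f(1) g(1)]] standard_mor_class[OF f(1)]
          standard_mor_class[OF g(1)] standard_act_comp[OF f(1) g(1)])
  qed (simp_all add: standard_mor_extensional[OF lambda_comp_in_hom[OF F G]])
  moreover have "standard_mor n m (delta_to_lambda n m f) = interval_mor {0..1} 0 1 n m f"
    if f: "f \<in> delta_hom n m" for n m f
  proof (rule extensionalityI)
    note L = delta_lift_lambda_map[OF f]
    have cls: "delta_to_lambda n m f = lambda_class n m (delta_lift n m f)"
      by (simp add: delta_to_lambda_def delta_lift_def[abs_def])
    show "standard_mor n m (delta_to_lambda n m f) \<in> extensional (unit_obj n)"
      by (rule standard_mor_extensional[OF delta_to_lambda_in_hom[OF f]])
    show "interval_mor {0..1} 0 1 n m f \<in> extensional (unit_obj n)"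
      by (simp add: interval_mor_def)
    fix \<beta> assume \<beta>: "\<beta> \<in> unit_obj n"
    \<comment> \<open>For simplicial maps nothing is subtracted, so the action is exactly reindexing
      by \<open>dual_map\<close>.\<close>
    have "lower_adj (delta_lift n m f) 0 = 0"
      using lower_adj_delta_lift[OF f, of 0] by (auto simp: dual_map_def intro!: Least_equality)
    then have "periodic_ext n \<beta> (lower_adj (delta_lift n m f) 0) = 0"
      using periodic_ext_of_nat[OF \<beta>, of 0] interval_objD(1)[OF \<beta>] by simp
    then show "standard_mor n m (delta_to_lambda n m f) \<beta> = interval_mor {0..1} 0 1 n m f \<beta>"
      unfolding cls standard_mor_class[OF L \<beta>]
      using \<beta> lower_adj_delta_lift[OF f] periodic_ext_of_nat[OF \<beta> dual_map_le]
      by (auto simp: standard_act_def interval_mor_def fun_eq_iff)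
  qed
  ultimately show ?thesis by (simp add: cyclic_structures_def lambda_functor_def)
qed

section \<open>A family of automorphisms indexed by the reals\<close>

definition power_aut :: "real \<Rightarrow> real \<Rightarrow> real" where
  "power_aut a = (\<lambda>x\<in>{0..1}. x powr exp a)"

lemma power_aut_in: "0 \<le> x \<Longrightarrow> x \<le> 1 \<Longrightarrow> 0 \<le> power_aut a x \<and> power_aut a x \<le> 1"
  by (simp add: power_aut_def powr_le1)

text \<open>The exponents \<open>exp a\<close> and \<open>exp (- a)\<close> multiply to 1; writing
  exponents this way keeps them positive for every real \<open>a\<close>.\<close>

lemma power_aut_uminus: "0 \<le> x \<Longrightarrow> x \<le> 1 \<Longrightarrow> power_aut (- a) (power_aut a x) = x"
  using power_aut_in[of x a] by (auto simp: power_aut_def powr_powr simp flip: exp_add)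

lemma power_aut_carrier: "power_aut a \<in> carrier (order_aut {0..1::real})"
proof -
  have "bij_betw (power_aut a) {0..1} {0..1}"
    by (rule bij_betw_byWitness[where f' = "power_aut (- a)"])
      (use power_aut_uminus[of _ a] power_aut_uminus[of _ "- a"] power_aut_in in auto)
  moreover have "power_aut a x \<le> power_aut a y \<longleftrightarrow> x \<le> y" if "x \<in> {0..1}" "y \<in> {0..1}" for x y
    using that powr_mono2[of "exp a" x y] powr_less_mono2[of "exp a" y x]
    by (auto simp: power_aut_def not_less[symmetric])
  ultimately show ?thesis by (simp add: order_aut_def Bij_def power_aut_def)
qed

lemma power_aut_inv: "inv\<^bsub>order_aut {0..1::real}\<^esub> (power_aut a) = power_aut (- a)"
proof (rule group.inv_equality[OF group_order_aut _ power_aut_carrier power_aut_carrier])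
  have "compose {0..1} (power_aut (- a)) (power_aut a) = (\<lambda>x\<in>{0..1}. x)"
    using power_aut_uminus[of _ a] by (auto simp: compose_def)
  then show "power_aut (- a) \<otimes>\<^bsub>order_aut {0..1}\<^esub> power_aut a = \<one>\<^bsub>order_aut {0..1}\<^esub>"
    by (simp add: order_aut_mult[OF power_aut_carrier power_aut_carrier] order_aut_one)
qed

text \<open>
  The involution of \<open>[0,1]\<close> given by the generator of the rotations of \<open>[1]\<close>; its only fixed point is
  the image of \<open>1/2\<close>, which therefore can be read off the structure.
\<close>

lemma conj_standard_rotation:
  assumes y: "0 \<le> y" "y \<le> 1"
  shows "conj_mor {0..1} 0 1 (power_aut a) standard_mor 1 1 (lambda_class 1 1 (arc 1 1 2)) (seq1 0 1 y) 1
    = power_aut a (1 - power_aut (- a) y)"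
proof -
  have int: "order_interval {0..1::real} 0 1" by (simp add: order_interval_def)
  have seq1_in: "seq1 0 1 u \<in> unit_obj 1" if "0 \<le> u" "u \<le> 1" for u
    using cyclic_structure.seq1_in[of "{0..1}" 0 1 unit_obj standard_mor u] that int
      standard_cyclic_structure by (simp add: cyclic_structure_def)
  note hom = lambda_class_in_hom[OF arc_lambda_map[of 1 1 2]]
  let ?z = "power_aut (- a) y"
  have z: "0 \<le> ?z" "?z \<le> 1" using power_aut_in[OF y] by auto
  have "aut_on_obj {0..1} 0 1 (power_aut (- a)) 1 (seq1 0 1 y) = seq1 0 1 ?z"
  proof (rule interval_obj_eqI)
    show "aut_on_obj {0..1} 0 1 (power_aut (- a)) 1 (seq1 0 1 y) \<in> unit_obj 1"
      by (rule aut_on_obj_apply[OF int power_aut_carrier seq1_in[OF y]])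
    fix j :: nat assume "1 \<le> j" "j \<le> 1"
    then show "aut_on_obj {0..1} 0 1 (power_aut (- a)) 1 (seq1 0 1 y) j = seq1 0 1 ?z j"
      using seq1_in[OF y] by (auto simp: aut_on_obj_def seq1_def)
  qed (rule seq1_in[OF z])
  \<comment> \<open>This arc has its cuts at 1 and 2, where the extension takes the values
    \<open>?z\<close> and 1.\<close>
  moreover have "standard_act 1 1 (arc 1 1 2) (seq1 0 1 ?z) 1 = 1 - ?z"
    using lower_adj_arc[of 1 2 1] periodic_ext_of_nat[OF seq1_in[OF z], of 1]
      periodic_ext_of_nat[OF seq1_in[OF z], of 2]
    by (simp add: standard_act_def seq1_def)
  moreover have "aut_on_obj {0..1} 0 1 (power_aut a) 1 \<beta> 1 = power_aut a (\<beta> 1)" if "\<beta> \<in> unit_obj 1" for \<beta>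
    using that by (simp add: aut_on_obj_def)
  ultimately show ?thesis
    using standard_act_in[OF arc_lambda_map seq1_in[OF z], of 1 2]
    by (simp only: conj_mor_apply[OF int power_aut_carrier standard_cyclic_structure hom seq1_in[OF y]]
        power_aut_inv standard_mor_class[OF arc_lambda_map seq1_in[OF z]])
qed

lemma real_lepoll_cyclic_structures: "(UNIV :: real set) \<lesssim> cyclic_structures {0..1::real} 0 1"
proof -
  let ?S = "\<lambda>a. aut_action {0..1} 0 1 (power_aut a) (unit_obj, standard_mor)"
  have int: "order_interval {0..1::real} 0 1" by (simp add: order_interval_def)
  note eq = aut_action_eq[OF int standard_cyclic_structure]
  have "a = c" if "?S a = ?S c" for a c
  proof -
    \<comment> \<open>The fixed point of the rotation in the structure for \<open>a\<close>. If the
      structure for \<open>c\<close> is the same, its rotation fixes \<open>y\<close> too, so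
      \<open>y\<close> is also the image of 1/2 under \<open>power_aut c\<close>, and the exponents
      agree.\<close>
    define y where "y = power_aut a (1/2)"
    have y: "0 \<le> y" "y \<le> 1" using power_aut_in[of "1/2" a] by (auto simp: y_def)
    have half: "power_aut (- a) y = 1/2"
      unfolding y_def by (rule power_aut_uminus) auto
    have "power_aut a (1 - power_aut (- a) y) = y"
      unfolding half by (simp add: y_def)
    then have "power_aut c (1 - power_aut (- c) y) = y"
      using that conj_standard_rotation[OF y, of a] conj_standard_rotation[OF y, of c] by (simp add: eq)
    then have "1 - power_aut (- c) y = power_aut (- c) y"
      using power_aut_uminus[of "1 - power_aut (- c) y" c] power_aut_in[OF y, of "- c"] by simp
    then have half: "power_aut (- c) y = 1/2" by simp
    have "y = power_aut c (1/2)"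
      using power_aut_uminus[OF y, of "- c"] unfolding half by simp
    then have "(1/2::real) powr exp a = (1/2) powr exp c"
      by (simp add: y_def power_aut_def)
    then show "a = c" by (simp add: powr_inj)
  qed
  then have "inj ?S" by (rule injI)
  moreover have "?S a \<in> cyclic_structures {0..1} 0 1" for a
    unfolding eq by (rule conj_mor_cyclic[OF int power_aut_carrier standard_cyclic_structure])
  ultimately show ?thesis by (auto simp: lepoll_def)
qed

theorem corollary5p3:
  fixes I :: "'a::linorder set" and b t :: 'a
  shows "(order_interval I b t \<longrightarrow>
            group_action (order_aut I) (cyclic_structures I b t) (aut_action I b t)) \<and>
         cyclic_structures {0..1::real} 0 1 \<approx> (UNIV :: real set)"
  using aut_action_group_action lepoll_antisym[OF cyclic_structures_lepoll_real real_lepoll_cyclic_structures]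
  by blast

end
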